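(* If $p\in\mathcal{H}_{n,d}(e)$ is strictly hyperbolic, then $\phi_{p,e}(\mathbb{R}^n,\mathbb{R}^d)=\Lambda_+(p,e)^*$.
   Context: A homogeneous polynomial $p\in\mathbb{R}[x_1,\ldots,x_n]$ of degree $d$ is hyperbolic with respect to $e\in\mathbb{R}^n$ if $p(e)>0$ and for every $x\in\mathbb{R}^n$ the polynomial $t\mapsto p(x+te)$ has only real zeros; $\mathcal{H}_{n,d}(e)$ is the set of such polynomials. The hyperbolic eigenvalues of $x\in\mathbb{R}^n$ are the $d$ zeros (with multiplicity) of $t\mapsto p(te-x)$. $p\in\mathcal{H}_{n,d}(e)$ is strictly hyperbolic if every $x\in\mathbb{R}^n$ that is not a multiple of $e$ has $d$ distinct hyperbolic eigenvalues. The hyperbolicity cone $\Lambda_+(p,e)$ is the set of $x\in\mathbb{R}^n$ all of whose hyperbolic eigenvalues are nonnegative, and its dual cone is $\Lambda_+(p,e)^*=\{\xi\in(\mathbb{R}^n)^*:\xi[x]\ge0\text{ for all }x\in\Lambda_+(p,e)\}$. For $x,u\in\mathbb{R}^n$ put $p_x(t)=p(x+te)$ and $D_up_x(t)=(D_up)(x+te)$, with $D_u$ the directional derivative. The parameterized Hermite matrix $H_{p,e}(x)[u]$ is the $d\times d$ Hankel matrix $[h_{i+j-1}]_{i,j=1}^d$, where $\frac{D_up_x(t)}{p_x(t)}=\sum_{k\ge1}h_kt^{-k}$ (expansion at infinity); it is linear in $u$. For $(x,y)\in\mathbb{R}^n\times\mathbb{R}^d$, $\phi_{p,e}(x,y)\in(\mathbb{R}^n)^*$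 is the linear functional $\phi_{p,e}(x,y)[u]=y^TH_{p,e}(x)[u]\,y$, and $\phi_{p,e}(\mathbb{R}^n,\mathbb{R}^d)$ is its image. *)

theory Defs
  imports
    "HOL-Analysis.Analysis"
    "HOL-Computational_Algebra.Computational_Algebra"
    "Jordan_Normal_Form.Matrix"
begin

text \<open>
  Polynomials in \<open>n\<close> real variables are represented by the functions they induce on
  \<open>real ^ 'n\<close>; over the infinite field of real numbers nothing is lost.
  \<open>homogeneous_form d p\<close> says that \<open>p\<close> is a real linear combination of monomials of
  total degree \<open>d\<close>, a monomial being given by its exponents \<open>\<alpha> :: 'n \<Rightarrow> nat\<close>.
\<close>

definition homogeneous_form :: "nat \<Rightarrow> (real ^ 'n \<Rightarrow> real) \<Rightarrow> bool" where
  "homogeneous_form d p \<longleftrightarrow>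
     (\<exists>c :: ('n \<Rightarrow> nat) \<Rightarrow> real. \<forall>x.
        p x = (\<Sum>\<alpha> | (\<Sum>i\<in>UNIV. \<alpha> i) = d. c \<alpha> * (\<Prod>i\<in>UNIV. (x $ i) ^ \<alpha> i)))"

lemma finite_exponents: "finite {\<alpha> :: 'n::finite \<Rightarrow> nat. (\<Sum>i\<in>UNIV. \<alpha> i) = d}"
proof (rule finite_subset)
  show "{\<alpha> :: 'n \<Rightarrow> nat. (\<Sum>i\<in>UNIV. \<alpha> i) = d} \<subseteq> PiE UNIV (\<lambda>_. {..d})"
    by (auto simp: PiE_def intro: member_le_sum)
  show "finite (PiE (UNIV :: 'n set) (\<lambda>_. {..d}))"
    by (intro finite_PiE) auto
qed

text \<open>
  The univariate polynomial inducing a given polynomial function.  It is only applied to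
  \<open>p\<close> and \<open>D\<^sub>u p\<close> along lines, see \<open>poly_poly_of_fun_line\<close> and
  \<open>poly_poly_of_fun_directional_derivative\<close> below.
\<close>

definition poly_of_fun :: "(real \<Rightarrow> real) \<Rightarrow> real poly" where
  "poly_of_fun f = (THE q. poly q = f)"

definition hyperbolic_forms :: "nat \<Rightarrow> real ^ 'n \<Rightarrow> (real ^ 'n \<Rightarrow> real) set" where
  "hyperbolic_forms d e =
     {p. homogeneous_form d p \<and> p e > 0 \<and>
         (\<forall>x. \<forall>z :: complex.
            poly (map_poly of_real (poly_of_fun (\<lambda>t. p (x + t *\<^sub>R e)))) z = 0 \<longrightarrow> z \<in> \<real>)}"

definition hyperbolic_eigenvalues ::
    "(real ^ 'n \<Rightarrow> real) \<Rightarrow> real ^ 'n \<Rightarrow> real ^ 'n \<Rightarrow> real multiset" where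
  "hyperbolic_eigenvalues p e x = proots (poly_of_fun (\<lambda>t. p (t *\<^sub>R e - x)))"

definition strictly_hyperbolic :: "nat \<Rightarrow> (real ^ 'n \<Rightarrow> real) \<Rightarrow> real ^ 'n \<Rightarrow> bool" where
  "strictly_hyperbolic d p e \<longleftrightarrow>
     (\<forall>x. (\<nexists>c. x = c *\<^sub>R e) \<longrightarrow> card (set_mset (hyperbolic_eigenvalues p e x)) = d)"

definition hyperbolicity_cone :: "(real ^ 'n \<Rightarrow> real) \<Rightarrow> real ^ 'n \<Rightarrow> (real ^ 'n) set" where
  "hyperbolicity_cone p e = {x. \<forall>\<mu> \<in># hyperbolic_eigenvalues p e x. \<mu> \<ge> 0}"

definition dual_cone :: "(real ^ 'n) set \<Rightarrow> (real ^ 'n \<Rightarrow> real) set" where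
  "dual_cone K = {\<xi>. linear \<xi> \<and> (\<forall>x\<in>K. \<xi> x \<ge> 0)}"

definition directional_derivative ::
    "real ^ 'n \<Rightarrow> (real ^ 'n \<Rightarrow> real) \<Rightarrow> real ^ 'n \<Rightarrow> real" where
  "directional_derivative u p x = deriv (\<lambda>s. p (x + s *\<^sub>R u)) 0"

text \<open>
  Expansion of a polynomial in \<open>t\<close> at infinity, as a formal Laurent series in the variable
  \<open>1 / t\<close>: the coefficient of \<open>t\<^sup>-\<^sup>k\<close> is the \<open>k\<close>-th coefficient of the series.  Quotients of
  polynomials are expanded by dividing in the field of formal Laurent series.
\<close>

definition expand_at_inf :: "real poly \<Rightarrow> real fls" where
  "expand_at_inf q = poly (map_poly fls_const q) fls_X_inv"

definition hermite_coeff ::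
    "(real ^ 'n \<Rightarrow> real) \<Rightarrow> real ^ 'n \<Rightarrow> real ^ 'n \<Rightarrow> real ^ 'n \<Rightarrow> nat \<Rightarrow> real" where
  "hermite_coeff p e x u k =
     fls_nth (expand_at_inf (poly_of_fun (\<lambda>t. directional_derivative u p (x + t *\<^sub>R e))) /
              expand_at_inf (poly_of_fun (\<lambda>t. p (x + t *\<^sub>R e))))
       (int k)"

text \<open>Rows and columns are counted from 0, hence the index \<open>i + j + 1\<close>.\<close>

definition hermite_matrix ::
    "nat \<Rightarrow> (real ^ 'n \<Rightarrow> real) \<Rightarrow> real ^ 'n \<Rightarrow> real ^ 'n \<Rightarrow> real ^ 'n \<Rightarrow> real mat" where
  "hermite_matrix d p e x u = mat d d (\<lambda>(i, j). hermite_coeff p e x u (i + j + 1))"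

definition hermite_map ::
    "nat \<Rightarrow> (real ^ 'n \<Rightarrow> real) \<Rightarrow> real ^ 'n \<Rightarrow> real ^ 'n \<Rightarrow> real vec \<Rightarrow> (real ^ 'n \<Rightarrow> real)" where
  "hermite_map d p e x y = (\<lambda>u. scalar_prod y (hermite_matrix d p e x u *\<^sub>v y))"

lemma poly_poly_of_fun:
  assumes "\<And>t. poly q t = f t"
  shows "poly (poly_of_fun f) t = f t"
proof -
  have "poly q = f"
    using assms by auto
  then have "poly_of_fun f = q"
    unfolding poly_of_fun_def by (auto simp: poly_eq_poly_eq_iff)
  with assms show ?thesis
    by simp
qed

lemma homogeneous_form_bivariate:
  fixes p :: "real ^ 'n \<Rightarrow> real"
  assumes "homogeneous_form d p"
  obtains Q :: "real poly poly"
    where "\<And>s t. p (a + t *\<^sub>R b + s *\<^sub>R u) = poly (poly Q [:s:]) t"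
proof -
  from assms obtain c :: "('n \<Rightarrow> nat) \<Rightarrow> real" where
    c: "\<And>x. p x = (\<Sum>\<alpha> | (\<Sum>i\<in>UNIV. \<alpha> i) = d. c \<alpha> * (\<Prod>i\<in>UNIV. (x $ i) ^ \<alpha> i))"
    unfolding homogeneous_form_def by auto
  define Q :: "real poly poly" where
    "Q = (\<Sum>\<alpha> | (\<Sum>i\<in>UNIV. \<alpha> i) = d.
            [:[:c \<alpha>:]:] * (\<Prod>i\<in>UNIV. [:[:a $ i, b $ i:], [:u $ i:]:] ^ \<alpha> i))"
  have "p (a + t *\<^sub>R b + s *\<^sub>R u) = poly (poly Q [:s:]) t" for s t
    unfolding c Q_def by (simp add: poly_sum poly_prod poly_power algebra_simps)
  then show ?thesis
    by (rule that)
qed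

lemma poly_poly_of_fun_line:
  assumes "homogeneous_form d p"
  shows "poly (poly_of_fun (\<lambda>t. p (x + t *\<^sub>R e))) t = p (x + t *\<^sub>R e)"
    and "poly (poly_of_fun (\<lambda>t. p (t *\<^sub>R e - x))) t = p (t *\<^sub>R e - x)"
proof -
  have *: "poly (poly_of_fun (\<lambda>t. p (a + t *\<^sub>R e))) t = p (a + t *\<^sub>R e)" for a
  proof -
    obtain Q where Q: "\<And>s t. p (a + t *\<^sub>R e + s *\<^sub>R 0) = poly (poly Q [:s:]) t"
      using homogeneous_form_bivariate[OF assms] by blast
    show ?thesis
      by (rule poly_poly_of_fun[of "poly Q [:0:]"]) (use Q[of _ 0] in simp)
  qed
  show "poly (poly_of_fun (\<lambda>t. p (x + t *\<^sub>R e))) t = p (x + t *\<^sub>R e)"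
    by (rule *)
  show "poly (poly_of_fun (\<lambda>t. p (t *\<^sub>R e - x))) t = p (t *\<^sub>R e - x)"
    using *[of "- x"] by simp
qed

lemma poly_poly_of_fun_directional_derivative:
  assumes "homogeneous_form d p"
  shows "poly (poly_of_fun (\<lambda>t. directional_derivative u p (x + t *\<^sub>R e))) t =
           directional_derivative u p (x + t *\<^sub>R e)"
proof -
  obtain Q where Q: "\<And>s t. p (x + t *\<^sub>R e + s *\<^sub>R u) = poly (poly Q [:s:]) t"
    using homogeneous_form_bivariate[OF assms] by blast
  have D: "((\<lambda>s. poly (poly R [:s:]) t) has_field_derivative poly (poly (pderiv R) [:s:]) t) (at s)"
    for R :: "real poly poly" and s t
  proof (induction R)
    case (pCons r R)
    then show ?case
      by (auto simp: pderiv_pCons intro!: derivative_eq_intros)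
  qed simp
  have "poly (poly (pderiv Q) [:0:]) t = directional_derivative u p (x + t *\<^sub>R e)" for t
    unfolding directional_derivative_def Q using DERIV_imp_deriv[OF D] by metis
  then show ?thesis
    by (rule poly_poly_of_fun)
qed

end

theory Submission
  imports Defs
begin

text \<open>
  Write \<open>D\<^sub>u\<close> for the directional derivative, and \<open>L\<^sub>w(u) = D\<^sub>u p(w) / D\<^sub>e p(w)\<close> for a simple zero \<open>w\<close>
  of \<open>p\<close> (simple in the direction \<open>e\<close>); up to sign this is the speed at which the zero moves
  along \<open>e\<close> when \<open>w\<close> is pushed in the direction \<open>u\<close>.  If \<open>t \<mapsto> p(x + te)\<close> has \<open>d\<close> distinct
  zeros \<open>a\<close>, partial fractions of \<open>D\<^sub>u p\<^sub>x / p\<^sub>x\<close> show that \<open>\<phi>(x,y)[u] = \<Sum>\<^sub>a L\<^bsub>x+ae\<^esub>(u) q\<^sub>y(a)\<^sup>2\<close>, where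
  \<open>q\<^sub>y\<close> is the polynomial with coefficient vector \<open>y\<close>.  If \<open>x\<close> is a multiple of \<open>e\<close>, then
  \<open>\<phi>(x,y)\<close> is a nonnegative multiple of the trace \<open>\<eta>(u) = D\<^sub>u p(e) / p(e)\<close>, the sum of the
  eigenvalues of \<open>u\<close>.  Comparing leading coefficients in the partial fractions also gives
  \<open>\<eta> = \<Sum>\<^sub>a L\<^bsub>x+ae\<^esub>\<close>, for every such \<open>x\<close>.

  The inclusion of the image in the dual cone therefore amounts to \<open>L\<^sub>w \<ge> 0\<close> on the cone
  (\<open>slope_nonneg\<close>).  If \<open>L\<^sub>w(u) < 0\<close>, then \<open>v = u - L\<^sub>w(u) e\<close> is interior to the cone and
  \<open>D\<^sub>v p(w) = 0\<close>, so that \<open>s \<mapsto> p(w + sv)\<close> has a multiple zero at \<open>0\<close>.  If \<open>w\<close> is in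
  the plane of \<open>e\<close> and \<open>v\<close>, then Euler's identity rules this out.  Otherwise it is impossible
  because that polynomial of degree \<open>d\<close> has \<open>d\<close> distinct real zeros (\<open>card_zeros_along_cone\<close>):
  the number of positive zeros of \<open>t \<mapsto> p(w + sv + te)\<close> falls from \<open>d\<close> to \<open>0\<close> as \<open>s\<close> runs
  through the real line, it changes by at most one at a time because all these zeros are
  simple, and it changes only where \<open>p(w + sv) = 0\<close>.

  Conversely let \<open>\<xi>\<close> be in the dual cone and \<open>d \<ge> 2\<close>.  Then \<open>\<eta> > 0\<close> on the cone without the
  origin, and with \<open>s\<close> the minimum of \<open>\<xi> / \<eta>\<close> the functional \<open>\<xi> - s \<eta>\<close> is nonnegative on the cone
  and vanishes at some \<open>z \<noteq> 0\<close> of it.  Either \<open>z\<close> is interior and \<open>\<xi> = s \<eta>\<close>, or \<open>z\<close> is a simple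
  zero of \<open>p\<close>, where the boundary of the cone is smooth (\<open>cone_tangent\<close>), so that
  \<open>\<xi> - s \<eta> = c L\<^sub>z\<close> with \<open>c \<ge> 0\<close> (\<open>supporting_functional\<close>).  In the latter case
  \<open>\<xi> = \<Sum>\<^sub>a w\<^sub>a L\<^bsub>z+ae\<^esub>\<close> with \<open>w\<^sub>0 = s + c\<close> and \<open>w\<^sub>a = s\<close> for the other zeros \<open>a\<close>, and
  interpolation provides \<open>y\<close> with \<open>q\<^sub>y(a)\<^sup>2 = w\<^sub>a\<close>.  For \<open>d = 1\<close> the cone is a half space, and the
  same argument applies with \<open>s = 0\<close> and \<open>z = 0\<close>; for \<open>d = 0\<close> both sides are \<open>{0}\<close>.
\<close>

section \<open>Univariate polynomials with prescribed zeros\<close>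

text \<open>
  The monic polynomial with simple zeros exactly at the points of the finite set \<open>R\<close>.
\<close>

definition root_poly :: "real set \<Rightarrow> real poly" where
  "root_poly R = (\<Prod>a\<in>R. [:- a, 1:])"

lemma poly_root_poly: "poly (root_poly R) t = (\<Prod>a\<in>R. t - a)"
  by (simp add: root_poly_def poly_prod)

lemma degree_root_poly: "degree (root_poly R) = card R"
  by (cases "finite R") (auto simp: root_poly_def degree_prod_eq_sum_degree)

lemma coeff_root_poly_card: "coeff (root_poly R) (card R) = 1"
  using lead_coeff_prod[of "\<lambda>a. [:- a, 1:]" R] degree_root_poly[of R]
  by (simp add: root_poly_def)

lemma root_poly_remove:
  assumes "finite R" "a \<in> R"
  shows "root_poly R = [:- a, 1:] * root_poly (R - {a})"
  unfolding root_poly_def by (rule prod.remove[OF assms])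

lemma poly_root_poly_remove_eq_0_iff:
  assumes "finite R"
  shows "poly (root_poly (R - {a})) b = 0 \<longleftrightarrow> b \<in> R - {a}"
  using assms by (auto simp: poly_root_poly)

lemma pderiv_root_poly:
  assumes "finite R" "a \<in> R"
  shows "poly (pderiv (root_poly R)) a = poly (root_poly (R - {a})) a"
  unfolding root_poly_remove[OF assms] pderiv_mult by (simp add: pderiv_pCons)

lemma eq_smult_root_poly:
  assumes "finite R" "degree P \<le> card R" "\<And>a. a \<in> R \<Longrightarrow> poly P a = 0"
  shows "P = Polynomial.smult (coeff P (card R)) (root_poly R)"
proof (rule poly_eqI_degree_lead_coeff[where A = R and n = "card R"])
  show "degree (Polynomial.smult (coeff P (card R)) (root_poly R)) \<le> card R"
    using degree_smult_le[of "coeff P (card R)" "root_poly R"] by (simp add: degree_root_poly)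
qed (use assms in \<open>auto simp: coeff_root_poly_card poly_root_poly\<close>)

text \<open>The interpolation polynomial with value \<open>v a\<close> at each node \<open>a \<in> R\<close>, in Lagrange's form.\<close>

definition lagrange_poly :: "real set \<Rightarrow> (real \<Rightarrow> real) \<Rightarrow> real poly" where
  "lagrange_poly R v =
     (\<Sum>a\<in>R. Polynomial.smult (v a / poly (root_poly (R - {a})) a) (root_poly (R - {a})))"

lemma poly_lagrange_poly:
  assumes "finite R" "b \<in> R"
  shows "poly (lagrange_poly R v) b = v b"
proof -
  have "poly (lagrange_poly R v) b =
      (\<Sum>a\<in>R. v a / poly (root_poly (R - {a})) a * poly (root_poly (R - {a})) b)"
    by (simp add: lagrange_poly_def poly_sum)
  also have "\<dots> = (\<Sum>a\<in>R. if a = b then v b else 0)"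
  proof (rule sum.cong)
    fix a assume "a \<in> R"
    with assms show "v a / poly (root_poly (R - {a})) a * poly (root_poly (R - {a})) b =
        (if a = b then v b else 0)"
      using poly_root_poly_remove_eq_0_iff[of R a b] by auto
  qed simp
  also have "\<dots> = v b"
    using assms by simp
  finally show ?thesis .
qed

lemma degree_lagrange_poly:
  assumes "finite R" "R \<noteq> {}"
  shows "degree (lagrange_poly R v) < card R"
proof -
  have "degree (lagrange_poly R v) \<le> card R - 1"
    unfolding lagrange_poly_def
  proof (rule degree_sum_le)
    fix a assume "a \<in> R"
    then show "degree (Polynomial.smult (v a / poly (root_poly (R - {a})) a) (root_poly (R - {a})))
        \<le> card R - 1"
      using assms(1) by (intro order_trans[OF degree_smult_le]) (simp add: degree_root_poly)
  qed (rule assms)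
  moreover have "card R > 0"
    using assms by (simp add: card_gt_0_iff)
  ultimately show ?thesis
    by linarith
qed

lemma eq_lagrange_poly:
  assumes "finite R" "degree Q < card R"
  shows "Q = lagrange_poly R (poly Q)"
proof (rule poly_eqI_degree[where A = R])
  show "degree (lagrange_poly R (poly Q)) < card R"
    using assms by (intro degree_lagrange_poly) auto
qed (use assms poly_lagrange_poly in auto)

lemma poly_eq_on_ray:
  fixes P Q :: "real poly"
  assumes "\<And>t. t > T \<Longrightarrow> poly P t = poly Q t"
  shows "P = Q"
proof (rule ccontr)
  assume "P \<noteq> Q"
  then have "finite {t. poly (P - Q) t = 0}"
    by (intro poly_roots_finite) simp
  moreover have "{T<..} \<subseteq> {t. poly (P - Q) t = 0}"
    using assms by auto
  ultimately have "finite {T<..}"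
    by (rule rev_finite_subset)
  then show False
    by (simp add: infinite_Ioi)
qed

text \<open>
  Homogeneity will give \<open>Q(t) = t\<^sup>m r(1/t)\<close> for the restrictions \<open>Q\<close> of a form of degree \<open>m\<close> to
  a line and \<open>r\<close> to another line, with \<open>r(0)\<close> the value at the point at infinity of the first.
\<close>

lemma degree_and_coeff_from_infinity:
  fixes Q r :: "real poly"
  assumes "\<And>t. t > 0 \<Longrightarrow> poly Q t = t ^ m * poly r (inverse t)"
  shows "degree Q \<le> m" and "coeff Q m = poly r 0"
proof -
  define N where "N = degree r"
  have *: "monom 1 N * Q = monom 1 m * reflect_poly r"
  proof (rule poly_eq_on_ray[of 0])
    fix t :: real assume "t > 0"
    then show "poly (monom 1 N * Q) t = poly (monom 1 m * reflect_poly r) t"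
      by (simp add: assms poly_reflect_poly_nz poly_monom N_def)
  qed
  have c: "coeff Q k = (if N + k < m then 0 else coeff (reflect_poly r) (N + k - m))" for k
    using arg_cong[OF *, of "\<lambda>P. coeff P (N + k)"] by (simp add: coeff_monom_mult)
  show "coeff Q m = poly r 0"
    using c[of m] by (simp add: coeff_reflect_poly N_def poly_0_coeff_0)
  show "degree Q \<le> m"
    by (rule degree_le) (auto simp: c coeff_reflect_poly N_def)
qed

section \<open>Expansion of rational functions at infinity\<close>

lemma expand_at_inf_pCons:
  "expand_at_inf (pCons a P) = fls_const a + fls_X_inv * expand_at_inf P"
  by (simp add: expand_at_inf_def map_poly_pCons)

lemma expand_at_inf_0: "expand_at_inf 0 = 0"
  by (simp add: expand_at_inf_def)

lemma fls_const_add: "fls_const (a + b) = fls_const a + fls_const (b :: real)"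
  by (intro fls_eqI) simp

lemma expand_at_inf_add: "expand_at_inf (P + Q) = expand_at_inf P + expand_at_inf Q"
  by (induction P Q rule: poly_induct2)
    (simp_all add: expand_at_inf_0 expand_at_inf_pCons fls_const_add algebra_simps)

lemma expand_at_inf_smult: "expand_at_inf (Polynomial.smult a P) = fls_const a * expand_at_inf P"
  by (induction P) (simp_all add: expand_at_inf_0 expand_at_inf_pCons algebra_simps
      flip: fls_const_mult_const)

lemma expand_at_inf_mult: "expand_at_inf (P * Q) = expand_at_inf P * expand_at_inf Q"
  by (induction P) (simp_all add: expand_at_inf_0 expand_at_inf_pCons expand_at_inf_add
      expand_at_inf_smult algebra_simps)

lemma expand_at_inf_sum: "expand_at_inf (\<Sum>a\<in>A. P a) = (\<Sum>a\<in>A. expand_at_inf (P a))"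
  by (induction A rule: infinite_finite_induct) (simp_all add: expand_at_inf_0 expand_at_inf_add)

lemma expand_at_inf_nth: "fls_nth (expand_at_inf P) (- int k) = coeff P k"
proof (induction P arbitrary: k)
  case (pCons a P)
  show ?case
  proof (cases k)
    case 0
    have "\<forall>n>0. fls_nth (expand_at_inf P) n = 0"
      by (induction P)
        (simp_all add: expand_at_inf_0 expand_at_inf_pCons fls_X_inv_times_conv_shift)
    with 0 show ?thesis
      by (simp add: expand_at_inf_pCons fls_X_inv_times_conv_shift)
  next
    case (Suc k')
    with pCons show ?thesis
      by (simp add: expand_at_inf_pCons fls_X_inv_times_conv_shift)
  qed
qed (simp add: expand_at_inf_0)

lemma expand_at_inf_nonzero: "P \<noteq> 0 \<Longrightarrow> expand_at_inf P \<noteq> 0"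
  using expand_at_inf_nth[of P "degree P"] by auto

text \<open>The geometric series \<open>1 / (t - a) = \<Sum>k. a\<^sup>k t\<^sup>-\<^sup>k\<^sup>-\<^sup>1\<close>.\<close>

lemma inverse_expand_at_inf_linear:
  "fls_nth (inverse (expand_at_inf [:- a, 1:])) (int k + 1) = a ^ k"
proof -
  define g :: "real fls" where "g = fps_to_fls (Abs_fps (\<lambda>k. if k = 0 then 0 else a ^ (k - 1)))"
  have g: "fls_nth g n = (if n \<ge> 1 then a ^ nat (n - 1) else 0)" for n
    by (auto simp: g_def nat_diff_distrib)
  have "expand_at_inf [:- a, 1:] * g = 1"
  proof (rule fls_eqI)
    fix n :: int
    show "fls_nth (expand_at_inf [:- a, 1:] * g) n = fls_nth 1 n"
    proof (cases "n \<ge> 1")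
      case True
      then have "nat n = Suc (nat (n - 1))"
        by simp
      then show ?thesis using True
        by (simp add: expand_at_inf_pCons expand_at_inf_0 distrib_right left_diff_distrib mult.assoc
            fls_X_inv_times_conv_shift g)
    next
      case False
      then show ?thesis
        by (auto simp: expand_at_inf_pCons expand_at_inf_0 distrib_right left_diff_distrib mult.assoc
            fls_X_inv_times_conv_shift g)
    qed
  qed
  then have "inverse (expand_at_inf [:- a, 1:]) = g"
    by (rule inverse_unique)
  then show ?thesis
    by (simp add: g)
qed

text \<open>
  A partial fraction decomposition \<open>Q / P = \<Sum>a\<in>R. w a / (t - a)\<close>, stated without division:
  \<open>F a\<close> is the cofactor of \<open>t - a\<close> in \<open>P\<close>.
\<close>

lemma expand_partial_fractions:
  assumes P: "P \<noteq> 0" "\<And>a. a \<in> R \<Longrightarrow> P = [:- a, 1:] * F a"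
    and Q: "Q = (\<Sum>a\<in>R. Polynomial.smult (w a) (F a))"
  shows "fls_nth (expand_at_inf Q / expand_at_inf P) (int k + 1) = (\<Sum>a\<in>R. w a * a ^ k)"
proof -
  have "expand_at_inf Q / expand_at_inf P =
      (\<Sum>a\<in>R. fls_const (w a) * (expand_at_inf (F a) / expand_at_inf P))"
    by (simp add: Q expand_at_inf_sum expand_at_inf_smult sum_divide_distrib)
  also have "\<dots> = (\<Sum>a\<in>R. fls_const (w a) * inverse (expand_at_inf [:- a, 1:]))"
  proof (rule sum.cong)
    fix a assume "a \<in> R"
    then have "P = [:- a, 1:] * F a" by (rule P(2))
    then have E: "expand_at_inf P = expand_at_inf [:- a, 1:] * expand_at_inf (F a)" and "F a \<noteq> 0"
      using P(1) by (auto simp only: expand_at_inf_mult mult_zero_right)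
    then have "expand_at_inf (F a) \<noteq> 0" by (intro expand_at_inf_nonzero)
    then have "expand_at_inf (F a) / expand_at_inf P = inverse (expand_at_inf [:- a, 1:])"
      unfolding E by (simp add: divide_inverse)
    then show "fls_const (w a) * (expand_at_inf (F a) / expand_at_inf P) =
        fls_const (w a) * inverse (expand_at_inf [:- a, 1:])" by simp
  qed simp
  finally show ?thesis
    by (simp add: fls_nth_sum inverse_expand_at_inf_linear)
qed

section \<open>Forms, their derivatives, and their restrictions to lines\<close>

text \<open>
  A form \<open>p\<close> of degree \<open>d\<close>.  Inside the locale, \<open>D u x\<close> is the derivative of \<open>p\<close> at \<open>x\<close> in the
  direction \<open>u\<close>, and \<open>line_poly x v\<close> is the polynomial \<open>t \<mapsto> p(x + tv)\<close>.
\<close>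

locale form =
  fixes p :: "real ^ 'n \<Rightarrow> real" and d :: nat
  assumes homogeneous: "homogeneous_form d p"
begin

abbreviation D :: "real ^ 'n \<Rightarrow> real ^ 'n \<Rightarrow> real" where
  "D u x \<equiv> directional_derivative u p x"

abbreviation line_poly :: "real ^ 'n \<Rightarrow> real ^ 'n \<Rightarrow> real poly" where
  "line_poly x v \<equiv> poly_of_fun (\<lambda>t. p (x + t *\<^sub>R v))"

lemma scale: "p (c *\<^sub>R x) = c ^ d * p x"
proof -
  obtain C where C: "\<And>x. p x =
      (\<Sum>\<alpha> | (\<Sum>i\<in>UNIV. \<alpha> i) = d. C \<alpha> * (\<Prod>i\<in>UNIV. (x $ i) ^ \<alpha> i))"
    using homogeneous unfolding homogeneous_form_def by auto
  have "p (c *\<^sub>R x) = (\<Sum>\<alpha> | (\<Sum>i\<in>UNIV. \<alpha> i) = d. c ^ d * (C \<alpha> * (\<Prod>i\<in>UNIV. (x $ i) ^ \<alpha> i)))"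
    unfolding C by (rule sum.cong) (auto simp: power_mult_distrib prod.distrib simp flip: power_sum)
  then show ?thesis
    by (simp add: C sum_distrib_left)
qed

lemma scale_uminus: "p (- x) = (- 1) ^ d * p x"
  using scale[of "- 1" x] by simp

lemma has_frechet_derivative: "(p has_derivative frechet_derivative p (at x)) (at x)"
proof -
  obtain C where C: "p = (\<lambda>x.
      \<Sum>\<alpha> | (\<Sum>i\<in>UNIV. \<alpha> i) = d. C \<alpha> * (\<Prod>i\<in>UNIV. (x $ i) ^ \<alpha> i))"
    using homogeneous unfolding homogeneous_form_def by auto
  have "p differentiable (at x)"
    unfolding C differentiable_def
    by (rule exI, rule has_derivative_sum, rule has_derivative_mult_right, rule has_derivative_prod,
        rule has_derivative_power, rule bounded_linear_imp_has_derivative,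
        rule bounded_linear_vec_nth)
  then show ?thesis
    by (simp add: frechet_derivative_works)
qed

lemma continuous: "continuous_on S p"
  by (intro continuous_at_imp_continuous_on ballI has_derivative_continuous[OF has_frechet_derivative])

lemma isCont: "isCont p x"
  using has_frechet_derivative has_derivative_continuous by blast

lemma has_derivative_line_frechet:
  "((\<lambda>s. p (x + s *\<^sub>R u)) has_field_derivative frechet_derivative p (at (x + s *\<^sub>R u)) u) (at s)"
proof -
  let ?f = "frechet_derivative p (at (x + s *\<^sub>R u))"
  have "((\<lambda>s. p (x + s *\<^sub>R u)) has_derivative (\<lambda>h. ?f (h *\<^sub>R u))) (at s)"
    by (rule has_derivative_compose[OF _ has_frechet_derivative]) (auto intro!: derivative_eq_intros)
  moreover have "?f (h *\<^sub>R u) = ?f u * h" for h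
    using has_frechet_derivative[THEN has_derivative_linear] by (simp add: linear_scale)
  ultimately show ?thesis
    by (simp add: has_field_derivative_def)
qed

lemma D_eq_frechet: "D u x = frechet_derivative p (at x) u"
  using has_derivative_line_frechet[of x u 0]
  by (simp add: directional_derivative_def DERIV_imp_deriv)

lemma has_derivative_line: "((\<lambda>s. p (x + s *\<^sub>R u)) has_field_derivative D u (x + s *\<^sub>R u)) (at s)"
  by (simp add: D_eq_frechet has_derivative_line_frechet)

lemma linear_D: "linear (\<lambda>u. D u x)"
  unfolding D_eq_frechet using has_frechet_derivative by (rule has_derivative_linear)

lemma euler: "D x x = real d * p x"
proof -
  have "((\<lambda>s. (1 + s) ^ d * p x) has_field_derivative real d * p x) (at 0)"
    by (auto intro!: derivative_eq_intros)
  moreover have "(\<lambda>s. (1 + s) ^ d * p x) = (\<lambda>s. p (x + s *\<^sub>R x))"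
    by (rule ext) (simp add: scale[symmetric] scaleR_left_distrib)
  moreover have "((\<lambda>s. p (x + s *\<^sub>R x)) has_field_derivative D x x) (at 0)"
    using has_derivative_line[of x x 0] by simp
  ultimately show ?thesis
    by (metis DERIV_unique)
qed

text \<open>
  Homogeneity of degree \<open>d - 1\<close> of \<open>D\<^sub>u p\<close>, multiplied by \<open>c\<close> so that \<open>d = 0\<close> needs no exception.
\<close>

lemma D_scale:
  assumes "c > 0"
  shows "c * D u (c *\<^sub>R x) = c ^ d * D u x"
proof -
  have "((\<lambda>s. c ^ d * p (x + s *\<^sub>R u)) has_field_derivative c ^ d * D u x) (at 0)"
    using has_derivative_line[of x u 0] by (intro DERIV_cmult) simp
  moreover have "((\<lambda>s. p (c *\<^sub>R x + s *\<^sub>R (c *\<^sub>R u))) has_field_derivative D (c *\<^sub>R u) (c *\<^sub>R x)) (at 0)"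
    using has_derivative_line[of "c *\<^sub>R x" "c *\<^sub>R u" 0] by simp
  moreover have "(\<lambda>s. p (c *\<^sub>R x + s *\<^sub>R (c *\<^sub>R u))) = (\<lambda>s. c ^ d * p (x + s *\<^sub>R u))"
    by (rule ext) (simp add: scale[symmetric] scaleR_right_distrib mult.commute)
  ultimately have "D (c *\<^sub>R u) (c *\<^sub>R x) = c ^ d * D u x"
    by (metis DERIV_unique)
  then show ?thesis
    by (simp add: linear_scale[OF linear_D])
qed

lemma poly_line_poly: "poly (line_poly x v) t = p (x + t *\<^sub>R v)"
  using poly_poly_of_fun_line[OF homogeneous] by simp

lemma poly_D_line: "poly (poly_of_fun (\<lambda>t. D u (x + t *\<^sub>R v))) t = D u (x + t *\<^sub>R v)"
  using poly_poly_of_fun_directional_derivative[OF homogeneous] by simp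

lemma poly_pderiv_line_poly: "poly (pderiv (line_poly x v)) t = D v (x + t *\<^sub>R v)"
proof (rule DERIV_unique)
  show "(poly (line_poly x v) has_field_derivative poly (pderiv (line_poly x v)) t) (at t)"
    by (rule poly_DERIV)
  have "poly (line_poly x v) = (\<lambda>t. p (x + t *\<^sub>R v))"
    by (rule ext) (rule poly_line_poly)
  then show "(poly (line_poly x v) has_field_derivative D v (x + t *\<^sub>R v)) (at t)"
    using has_derivative_line by simp
qed

lemma degree_line_poly: "degree (line_poly x v) \<le> d"
  and coeff_line_poly: "coeff (line_poly x v) d = p v"
proof -
  have *: "poly (line_poly x v) t = t ^ d * poly (line_poly v x) (inverse t)" if "t > 0" for t
    using that scale[of t "v + inverse t *\<^sub>R x"]
    by (simp add: poly_line_poly scaleR_right_distrib add.commute)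
  \<comment> \<open>the point at infinity of the line \<open>x + tv\<close> is \<open>v\<close>\<close>
  from degree_and_coeff_from_infinity[of "line_poly x v" d "line_poly v x", OF *]
  show "degree (line_poly x v) \<le> d" and "coeff (line_poly x v) d = p v"
    by (auto simp: poly_line_poly)
qed

lemma degree_D_line: "d \<ge> 1 \<Longrightarrow> degree (poly_of_fun (\<lambda>t. D u (x + t *\<^sub>R v))) \<le> d - 1"
  and coeff_D_line: "d \<ge> 1 \<Longrightarrow> coeff (poly_of_fun (\<lambda>t. D u (x + t *\<^sub>R v))) (d - 1) = D u v"
proof -
  let ?Q = "\<lambda>x v. poly_of_fun (\<lambda>t. D u (x + t *\<^sub>R v))"
  assume d: "d \<ge> 1"
  have *: "poly (?Q x v) t = t ^ (d - 1) * poly (?Q v x) (inverse t)" if "t > 0" for t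
  proof -
    have "t *\<^sub>R (v + inverse t *\<^sub>R x) = x + t *\<^sub>R v"
      using that by (simp add: scaleR_right_distrib)
    with D_scale[OF that, of u "v + inverse t *\<^sub>R x"] that d show ?thesis
      by (simp add: poly_D_line power_eq_if)
  qed
  from degree_and_coeff_from_infinity[of "?Q x v" "d - 1" "?Q v x", OF *]
  show "degree (?Q x v) \<le> d - 1" and "coeff (?Q x v) (d - 1) = D u v"
    by (auto simp: poly_D_line)
qed

lemma line_poly_nonzero: "p v \<noteq> 0 \<Longrightarrow> line_poly x v \<noteq> 0"
  using coeff_line_poly[of x v] by auto

lemma finite_line_zeros: "p v \<noteq> 0 \<Longrightarrow> finite {t. p (x + t *\<^sub>R v) = 0}"
  using poly_roots_finite[OF line_poly_nonzero[of v x]] by (simp add: poly_line_poly)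

lemma card_line_zeros: "p v \<noteq> 0 \<Longrightarrow> card {t. p (x + t *\<^sub>R v) = 0} \<le> d"
  using card_poly_roots_bound[OF line_poly_nonzero[of v x]] degree_line_poly[of x v]
  by (simp add: poly_line_poly)

lemma line_poly_eq_root_poly:
  assumes "finite R" "card R = d" "\<And>a. a \<in> R \<Longrightarrow> p (x + a *\<^sub>R v) = 0"
  shows "line_poly x v = Polynomial.smult (p v) (root_poly R)"
  using eq_smult_root_poly[of R "line_poly x v"] assms degree_line_poly[of x v] coeff_line_poly[of x v]
  by (simp add: poly_line_poly)

lemma D_at_zero:
  assumes "finite R" "card R = d" "\<And>a. a \<in> R \<Longrightarrow> p (x + a *\<^sub>R v) = 0" "a \<in> R"
  shows "D v (x + a *\<^sub>R v) = p v * poly (root_poly (R - {a})) a"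
  using poly_pderiv_line_poly[of x v a] assms
  by (simp add: line_poly_eq_root_poly[OF assms(1-3)] pderiv_smult pderiv_root_poly)

lemma D_at_zero_nonzero:
  assumes "finite R" "card R = d" "\<And>a. a \<in> R \<Longrightarrow> p (x + a *\<^sub>R v) = 0" "a \<in> R" "p v \<noteq> 0"
  shows "D v (x + a *\<^sub>R v) \<noteq> 0"
  using assms poly_root_poly_remove_eq_0_iff[OF assms(1), of a a]
  by (simp add: D_at_zero[OF assms(1-4)])

end

section \<open>The hyperbolicity cone of a strictly hyperbolic form\<close>

text \<open>
  The form taken by strict hyperbolicity in the proof: every line parallel to \<open>e\<close>, other than
  the axis through the origin, meets the zero set of \<open>p\<close> in exactly \<open>d\<close> points.  Real-rootedness
  of \<open>p\<close> on these lines is then automatic.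
\<close>

locale strict_form = form p d for p :: "real ^ 'n \<Rightarrow> real" and d :: nat +
  fixes e :: "real ^ 'n"
  assumes pos: "p e > 0"
    and strict: "x \<notin> span {e} \<Longrightarrow> card {t. p (x + t *\<^sub>R e) = 0} = d"
begin

text \<open>
  The hyperbolicity cone, without reference to eigenvalues: since the eigenvalues of \<open>x\<close> are
  the \<open>-t\<close> with \<open>p(x + te) = 0\<close>, they are nonnegative iff \<open>p\<close> does not vanish, and hence is
  positive, on the open ray from \<open>x\<close> in the direction \<open>e\<close>; see \<open>cone_iff\<close> and
  \<open>hyperbolicity_cone_eq\<close>.
\<close>

definition hyp_cone :: "(real ^ 'n) set" where
  "hyp_cone = {x. \<forall>t>0. p (x + t *\<^sub>R e) > 0}"

text \<open>
  \<open>slope u w\<close> is meant for simple zeros \<open>w\<close> of \<open>p\<close>: the zero of \<open>t \<mapsto> p(w + su + te)\<close> that starts at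
  \<open>t = 0\<close> has derivative \<open>- slope u w\<close> at \<open>s = 0\<close>.  \<open>hyp_trace u\<close> is the sum of the eigenvalues
  of \<open>u\<close>, see \<open>trace_eq_sum_zeros\<close> and \<open>trace_on_axis\<close>.  Comments write \<open>L\<^sub>w(u)\<close> for \<open>slope u w\<close>
  and \<open>\<eta>\<close> for \<open>hyp_trace\<close>.
\<close>

abbreviation slope :: "real ^ 'n \<Rightarrow> real ^ 'n \<Rightarrow> real" where
  "slope u w \<equiv> D u w / D e w"

abbreviation hyp_trace :: "real ^ 'n \<Rightarrow> real" where
  "hyp_trace u \<equiv> D u e / p e"

lemma pos_nonzero: "p e \<noteq> 0"
  using pos by simp

lemma finite_zeros: "finite {t. p (x + t *\<^sub>R e) = 0}"
  by (rule finite_line_zeros[OF pos_nonzero])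

lemma zero_imp_degree_pos: "p w = 0 \<Longrightarrow> d \<ge> 1"
  using scale[of 0 w] scale[of 0 e] pos by (cases d) auto

lemma simple_zero:
  assumes "card {t. p (x + t *\<^sub>R e) = 0} = d" "p (x + a *\<^sub>R e) = 0"
  shows "D e (x + a *\<^sub>R e) \<noteq> 0"
  using D_at_zero_nonzero[OF finite_zeros assms(1)] assms(2) pos_nonzero by auto

lemma simple_zero': "w \<notin> span {e} \<Longrightarrow> p w = 0 \<Longrightarrow> D e w \<noteq> 0"
  using simple_zero[OF strict, of w 0] by simp

lemma cone_iff: "x \<in> hyp_cone \<longleftrightarrow> (\<forall>t>0. p (x + t *\<^sub>R e) \<noteq> 0)"
proof
  assume nz: "\<forall>t>0. p (x + t *\<^sub>R e) \<noteq> 0"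
  show "x \<in> hyp_cone"
    unfolding hyp_cone_def
  proof (intro CollectI allI impI, rule ccontr)
    fix t :: real assume t: "t > 0" and "\<not> p (x + t *\<^sub>R e) > 0"
    with nz have neg: "p (x + t *\<^sub>R e) < 0"
      by (meson linorder_less_linear)
    \<comment> \<open>the segment from \<open>x + te\<close> to \<open>e\<close> projects from the origin to the ray beyond \<open>x + te\<close>\<close>
    let ?g = "\<lambda>\<theta>. (1 - \<theta>) *\<^sub>R (x + t *\<^sub>R e) + \<theta> *\<^sub>R e"
    have "continuous_on {0..1} (\<lambda>\<theta>. p (?g \<theta>))"
      by (rule continuous_on_compose2[OF continuous[of UNIV]]) (auto intro!: continuous_intros)
    then obtain \<theta> where \<theta>: "0 \<le> \<theta>" "\<theta> \<le> 1" "p (?g \<theta>) = 0"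
      using IVT'[of "\<lambda>\<theta>. p (?g \<theta>)" 0 0 1] neg pos by auto
    with pos have "\<theta> < 1"
      by (cases "\<theta> = 1") auto
    have "?g \<theta> = (1 - \<theta>) *\<^sub>R (x + (t + \<theta> / (1 - \<theta>)) *\<^sub>R e)"
    proof -
      have "(1 - \<theta>) * (t + \<theta> / (1 - \<theta>)) = (1 - \<theta>) * t + \<theta>"
        using \<open>\<theta> < 1\<close> by (simp add: distrib_left)
      then show ?thesis
        using \<open>\<theta> < 1\<close> by (simp add: scaleR_right_distrib scaleR_left_distrib)
    qed
    with \<theta>(3) \<open>\<theta> < 1\<close> have "p (x + (t + \<theta> / (1 - \<theta>)) *\<^sub>R e) = 0"
      by (simp add: scale)
    moreover have "t + \<theta> / (1 - \<theta>) > 0"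
      using t \<theta> \<open>\<theta> < 1\<close> by (simp add: add_pos_nonneg)
    ultimately show False
      using nz by blast
  qed
next
  assume x: "x \<in> hyp_cone"
  show "\<forall>t>0. p (x + t *\<^sub>R e) \<noteq> 0"
  proof (intro allI impI)
    fix t :: real assume "t > 0"
    with x have "p (x + t *\<^sub>R e) > 0"
      by (simp add: hyp_cone_def)
    then show "p (x + t *\<^sub>R e) \<noteq> 0"
      by simp
  qed
qed

lemma cone_scale:
  assumes "c > 0" "x \<in> hyp_cone"
  shows "c *\<^sub>R x \<in> hyp_cone"
  unfolding hyp_cone_def
proof (intro CollectI allI impI)
  fix t :: real assume "t > 0"
  have "p (c *\<^sub>R x + t *\<^sub>R e) = c ^ d * p (x + (t / c) *\<^sub>R e)"
    using scale[of c "x + (t / c) *\<^sub>R e"] assms(1) by (simp add: scaleR_right_distrib)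
  then show "p (c *\<^sub>R x + t *\<^sub>R e) > 0"
    using assms \<open>t > 0\<close> by (simp add: hyp_cone_def)
qed

lemma e_in_cone: "c > 0 \<Longrightarrow> c *\<^sub>R e \<in> hyp_cone"
proof -
  assume "c > 0"
  have "p (c *\<^sub>R e + t *\<^sub>R e) > 0" if "t > 0" for t
    using that \<open>c > 0\<close> pos by (simp add: scale flip: scaleR_left_distrib)
  then show ?thesis
    by (simp add: hyp_cone_def)
qed

lemma cone_add_e:
  assumes "u \<in> hyp_cone" "c > 0"
  shows "u + c *\<^sub>R e \<in> hyp_cone" "p (u + c *\<^sub>R e) > 0"
  using assms by (auto simp: hyp_cone_def add.assoc simp flip: scaleR_left_distrib)

text \<open>
  Openness of the interior of the cone.  By homogeneity, positivity of \<open>p\<close> on the ray from \<open>x\<close>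
  in the direction \<open>e\<close> is positivity on the segment from \<open>x\<close> to \<open>e\<close>, which is compact.
\<close>

lemma eventually_in_cone:
  assumes "x \<in> hyp_cone" "p x > 0"
  shows "\<forall>\<^sub>F y in nhds x. y \<in> hyp_cone \<and> p y > 0"
proof -
  have pos_ray: "p (x + t *\<^sub>R e) > 0" if "t \<ge> 0" for t
    using that assms by (cases "t = 0") (auto simp: hyp_cone_def)
  have seg: "p z > 0" if z: "z \<in> closed_segment x e" for z
  proof -
    obtain \<theta> where \<theta>: "0 \<le> \<theta>" "\<theta> \<le> 1" "z = (1 - \<theta>) *\<^sub>R x + \<theta> *\<^sub>R e"
      using z by (auto simp: in_segment)
    show ?thesis
    proof (cases "\<theta> = 1")
      case False
      with \<theta>(3) have "p z = (1 - \<theta>) ^ d * p (x + (\<theta> / (1 - \<theta>)) *\<^sub>R e)"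
        by (simp add: scaleR_right_distrib flip: scale)
      with False \<theta>(1,2) pos_ray[of "\<theta> / (1 - \<theta>)"] show ?thesis
        by simp
    qed (use \<theta> pos in simp)
  qed
  have "closed {z. p z \<le> 0}"
    by (intro closed_Collect_le continuous continuous_on_const)
  moreover have "closed_segment x e \<inter> {z. p z \<le> 0} = {}"
    using seg by fastforce
  ultimately obtain \<epsilon> where \<epsilon>: "\<epsilon> > 0"
    "\<And>a b. a \<in> closed_segment x e \<Longrightarrow> p b \<le> 0 \<Longrightarrow> \<epsilon> \<le> dist a b"
    using separate_compact_closed[OF compact_segment, of "{z. p z \<le> 0}" x e] by auto
  have ray: "p (y + t *\<^sub>R e) > 0" if "dist y x < \<epsilon>" "t \<ge> 0" for y t
  proof (rule ccontr)
    assume neg: "\<not> p (y + t *\<^sub>R e) > 0"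
    define c where "c = inverse (1 + t)"
    have c: "0 < c" "c \<le> 1" "c * t = 1 - c"
      using that by (auto simp: c_def field_simps)
    have "c *\<^sub>R x + (1 - c) *\<^sub>R e \<in> closed_segment x e"
      unfolding in_segment using c by (intro exI[of _ "1 - c"]) auto
    moreover have "p (c *\<^sub>R (y + t *\<^sub>R e)) \<le> 0"
      using neg c(1) unfolding scale by (intro mult_nonneg_nonpos) auto
    ultimately have "\<epsilon> \<le> dist (c *\<^sub>R x + (1 - c) *\<^sub>R e) (c *\<^sub>R (y + t *\<^sub>R e))"
      by (rule \<epsilon>(2))
    also have "\<dots> = c * dist x y"
      using c by (simp add: scaleR_right_distrib dist_norm flip: scaleR_diff_right)
    also have "\<dots> \<le> dist y x"
      using c by (simp add: dist_commute mult_left_le_one_le)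
    finally show False
      using that by simp
  qed
  have "\<forall>\<^sub>F y in nhds x. dist y x < \<epsilon>"
    using \<epsilon>(1) by (auto simp: eventually_nhds_metric)
  then show ?thesis
  proof eventually_elim
    case (elim y)
    then show ?case
      using ray[of y] ray[of y 0] by (auto simp: hyp_cone_def)
  qed
qed

section \<open>Persistence of simple zeros\<close>

lemma zero_persists:
  assumes "p (x + a *\<^sub>R e) = 0" "D e (x + a *\<^sub>R e) \<noteq> 0" "open V" "a \<in> V"
  shows "\<forall>\<^sub>F y in nhds x. \<exists>t\<in>V. p (y + t *\<^sub>R e) = 0"
proof -
  define c where "c = D e (x + a *\<^sub>R e)"
  have "((\<lambda>t. p (x + t *\<^sub>R e) / (t - a)) \<longlongrightarrow> c) (at a)"
    using has_derivative_line[of x e a] assms(1) by (simp add: has_field_derivative_iff c_def)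
  then have "((\<lambda>t. p (x + t *\<^sub>R e) / (t - a) * c) \<longlongrightarrow> c * c) (at a)"
    by (intro tendsto_intros)
  moreover have "c * c > 0"
    using assms(2) by (auto simp: c_def zero_less_mult_iff neq_iff)
  ultimately have "\<forall>\<^sub>F t in at a. p (x + t *\<^sub>R e) / (t - a) * c > 0"
    by (rule order_tendstoD)
  then obtain \<epsilon>1 where \<epsilon>1: "\<epsilon>1 > 0"
    "\<And>t. t \<noteq> a \<Longrightarrow> dist t a < \<epsilon>1 \<Longrightarrow> p (x + t *\<^sub>R e) / (t - a) * c > 0"
    by (auto simp: eventually_at)
  obtain \<epsilon>2 where \<epsilon>2: "\<epsilon>2 > 0" "ball a \<epsilon>2 \<subseteq> V"
    using assms(3,4) by (auto simp: open_contains_ball)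
  define h where "h = min \<epsilon>1 \<epsilon>2 / 2"
  have h: "h > 0" "h < \<epsilon>1" "h < \<epsilon>2"
    using \<epsilon>1 \<epsilon>2 by (auto simp: h_def)
  \<comment> \<open>the sign change between \<open>a - h\<close> and \<open>a + h\<close> survives small perturbations of the line\<close>
  have "p (x + (a + h) *\<^sub>R e) / h * c > 0" "p (x + (a - h) *\<^sub>R e) / (- h) * c > 0"
    using \<epsilon>1(2)[of "a + h"] \<epsilon>1(2)[of "a - h"] h by (auto simp: dist_norm)
  then have sign: "p (x + (a - h) *\<^sub>R e) * p (x + (a + h) *\<^sub>R e) < 0"
    using h by (auto simp: zero_less_mult_iff zero_less_divide_iff divide_less_0_iff mult_less_0_iff)
  have "((\<lambda>y. p (y + (a - h) *\<^sub>R e) * p (y + (a + h) *\<^sub>R e)) \<longlongrightarrow>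
      p (x + (a - h) *\<^sub>R e) * p (x + (a + h) *\<^sub>R e)) (nhds x)"
    by (intro tendsto_intros isCont_tendsto_compose[OF isCont]) (simp_all add: filterlim_ident)
  from order_tendstoD(2)[OF this sign]
  have "\<forall>\<^sub>F y in nhds x. p (y + (a - h) *\<^sub>R e) * p (y + (a + h) *\<^sub>R e) < 0" .
  then show ?thesis
  proof eventually_elim
    case (elim y)
    then obtain t where "a - h < t" "t < a + h" "p (y + t *\<^sub>R e) = 0"
      using poly_IVT[of "a - h" "a + h" "line_poly y e"] h by (auto simp: poly_line_poly)
    moreover from this h have "t \<in> V"
      using \<epsilon>2 by (intro subsetD[OF \<epsilon>2(2)]) (auto simp: dist_norm abs_less_iff)
    ultimately show ?case
      by blast
  qed
qed

text \<open>
  The number of zeros in an open set \<open>U\<close> cannot drop under small perturbations of a line on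
  which all zeros are simple: each zero persists in a neighbourhood of its own.
\<close>

lemma card_zeros_lower_semicontinuous:
  assumes "card {t. p (x + t *\<^sub>R e) = 0} = d" "open U"
  shows "\<forall>\<^sub>F y in nhds x. card {t\<in>U. p (x + t *\<^sub>R e) = 0} \<le> card {t\<in>U. p (y + t *\<^sub>R e) = 0}"
proof -
  define Z where "Z = {t\<in>U. p (x + t *\<^sub>R e) = 0}"
  have fin: "finite {t\<in>U. p (y + t *\<^sub>R e) = 0}" for y
    by (rule finite_subset[OF _ finite_zeros[of y]]) auto
  then have "finite Z"
    by (simp add: Z_def)
  then have "\<forall>a. \<exists>\<delta>>0. \<forall>b\<in>Z. b \<noteq> a \<longrightarrow> \<delta> \<le> dist a b"
    using finite_set_avoid by blast
  then obtain \<delta> where \<delta>: "\<And>a. \<delta> a > 0" "\<And>a b. b \<in> Z \<Longrightarrow> b \<noteq> a \<Longrightarrow> \<delta> a \<le> dist a b"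
    by metis
  have "\<forall>\<^sub>F y in nhds x. \<forall>a\<in>Z. \<exists>t\<in>U \<inter> ball a (\<delta> a / 2). p (y + t *\<^sub>R e) = 0"
  proof (rule eventually_ball_finite[OF \<open>finite Z\<close>], rule ballI)
    fix a assume "a \<in> Z"
    then show "\<forall>\<^sub>F y in nhds x. \<exists>t\<in>U \<inter> ball a (\<delta> a / 2). p (y + t *\<^sub>R e) = 0"
      using assms \<delta>(1)[of a] by (intro zero_persists simple_zero) (auto simp: Z_def)
  qed
  then show ?thesis
  proof eventually_elim
    case (elim y)
    then obtain g where g: "\<And>a. a \<in> Z \<Longrightarrow> g a \<in> U \<inter> ball a (\<delta> a / 2)"
      "\<And>a. a \<in> Z \<Longrightarrow> p (y + g a *\<^sub>R e) = 0"
      by metis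
    have "inj_on g Z"
    proof (rule inj_onI, rule ccontr)
      fix a b assume ab: "a \<in> Z" "b \<in> Z" "g a = g b" "a \<noteq> b"
      have "dist a b < \<delta> a / 2 + \<delta> b / 2"
        using g(1)[of a] g(1)[of b] ab dist_triangle[of a b "g a"] by (auto simp: dist_commute)
      moreover have "\<delta> a \<le> dist a b" "\<delta> b \<le> dist a b"
        using \<delta>(2)[of b a] \<delta>(2)[of a b] ab by (auto simp: dist_commute)
      ultimately show False
        by simp
    qed
    then show ?case
      unfolding Z_def[symmetric] using g by (intro card_inj_on_le[OF _ _ fin]) auto
  qed
qed

section \<open>Zeros along directions in the cone\<close>

text \<open>
  In the direction of an interior point \<open>v\<close> of the cone, too, \<open>p\<close> has \<open>d\<close> distinct real zeros
  on a line through \<open>w\<close>.  The proof counts the zeros \<open>t\<close> of \<open>p(w + sv + te)\<close> by sign: \<open>N s\<close>, \<open>M s\<close> and \<open>z s\<close> are the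
  numbers of positive, negative and vanishing ones.  Semicontinuity of \<open>N\<close> and of \<open>M\<close> gives
  \<open>N s \<le> N r \<le> N s + z s\<close> for \<open>r\<close> near \<open>s\<close>.  As \<open>N\<close> falls from \<open>d\<close> to \<open>0\<close>, there is for each \<open>k\<close>
  from \<open>1\<close> to \<open>d\<close> a last point \<open>\<sigma> k\<close> at which it falls below \<open>k\<close>.  There \<open>N\<close> has the value
  \<open>k - 1\<close> and \<open>p(w + sv)\<close> a zero, so that these are \<open>d\<close> distinct zeros.
\<close>

lemma card_zeros_along_cone:
  assumes v: "v \<in> hyp_cone" "p v > 0" and w: "w \<notin> span {e, v}"
  shows "card {s. p (w + s *\<^sub>R v) = 0} = d"
proof -
  define Z where "Z U s = {t\<in>U. p (w + s *\<^sub>R v + t *\<^sub>R e) = 0}" for U :: "real set" and s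
  define N where "N s = card (Z {0<..} s)" for s
  define M where "M s = card (Z {..<0} s)" for s
  define z where "z s = (if p (w + s *\<^sub>R v) = 0 then 1 else 0 :: nat)" for s
  have nonmult: "w + s *\<^sub>R v \<notin> span {e}" for s
  proof
    assume "w + s *\<^sub>R v \<in> span {e}"
    then have "w + s *\<^sub>R v \<in> span {e, v}"
      using span_mono[of "{e}" "{e, v}"] by auto
    then have "(w + s *\<^sub>R v) - s *\<^sub>R v \<in> span {e, v}"
      by (intro span_diff span_scale) (auto intro: span_base)
    with w show False
      by simp
  qed
  have fin: "finite (Z U s)" for U s
    by (rule finite_subset[OF _ finite_zeros[of "w + s *\<^sub>R v"]]) (auto simp: Z_def)
  have total: "N s + M s + z s = d" for s
  proof -
    have "{t. p (w + s *\<^sub>R v + t *\<^sub>R e) = 0} = Z {0<..} s \<union> Z {..<0} s \<union> Z {0} s"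
      by (auto simp: Z_def)
    then have "d = card (Z {0<..} s \<union> Z {..<0} s \<union> Z {0} s)"
      using strict[OF nonmult[of s]] by simp
    also have "\<dots> = card (Z {0<..} s \<union> Z {..<0} s) + card (Z {0} s)"
      by (intro card_Un_disjoint finite_UnI fin) (auto simp: Z_def)
    also have "card (Z {0<..} s \<union> Z {..<0} s) = N s + M s"
      unfolding N_def M_def by (intro card_Un_disjoint finite_UnI fin) (auto simp: Z_def)
    also have "Z {0} s = (if p (w + s *\<^sub>R v) = 0 then {0} else {})"
      by (auto simp: Z_def)
    then have "card (Z {0} s) = z s"
      by (simp add: z_def)
    finally show ?thesis
      by simp
  qed
  have semi: "\<forall>\<^sub>F r in nhds s. card (Z U s) \<le> card (Z U r)" if "open U" for U s
  proof -
    have "((\<lambda>r. w + r *\<^sub>R v) \<longlongrightarrow> w + s *\<^sub>R v) (nhds s)"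
      by (intro tendsto_intros) (simp add: filterlim_ident)
    with card_zeros_lower_semicontinuous[OF strict[OF nonmult[of s]] that] show ?thesis
      unfolding Z_def by (rule eventually_compose_filterlim)
  qed
  have "\<forall>\<^sub>F s in at_top. v + inverse s *\<^sub>R w \<in> hyp_cone \<and> p (v + inverse s *\<^sub>R w) > 0"
  proof (rule eventually_compose_filterlim[OF eventually_in_cone[OF v]])
    have "((\<lambda>s. v + inverse s *\<^sub>R w) \<longlongrightarrow> v + 0 *\<^sub>R w) at_top"
      by (intro tendsto_intros tendsto_inverse_0_at_top filterlim_ident)
    then show "((\<lambda>s. v + inverse s *\<^sub>R w) \<longlongrightarrow> v) at_top" by simp
  qed
  moreover have "\<forall>\<^sub>F s in at_top. v - inverse s *\<^sub>R w \<in> hyp_cone \<and> p (v - inverse s *\<^sub>R w) > 0"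
  proof (rule eventually_compose_filterlim[OF eventually_in_cone[OF v]])
    have "((\<lambda>s. v - inverse s *\<^sub>R w) \<longlongrightarrow> v - 0 *\<^sub>R w) at_top"
      by (intro tendsto_intros tendsto_inverse_0_at_top filterlim_ident)
    then show "((\<lambda>s. v - inverse s *\<^sub>R w) \<longlongrightarrow> v) at_top" by simp
  qed
  ultimately have "\<forall>\<^sub>F s in at_top. N s = 0 \<and> N (- s) = d"
    using eventually_gt_at_top[of 0]
  proof eventually_elim
    case (elim s)
    have "s *\<^sub>R (v + inverse s *\<^sub>R w) = w + s *\<^sub>R v" "s *\<^sub>R (v - inverse s *\<^sub>R w) = s *\<^sub>R v - w"
      using elim by (auto simp: scaleR_right_distrib scaleR_right_diff_distrib)
    then have in_cone: "w + s *\<^sub>R v \<in> hyp_cone" "s *\<^sub>R v - w \<in> hyp_cone" and p_pos: "p (s *\<^sub>R v - w) > 0"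
      using elim cone_scale[of s "v + inverse s *\<^sub>R w"] cone_scale[of s "v - inverse s *\<^sub>R w"]
        scale[of s "v - inverse s *\<^sub>R w"] by auto
    have "Z {0<..} s = {}"
      using in_cone(1) by (auto simp: Z_def cone_iff)
    moreover have neg: "p (w + (- s) *\<^sub>R v + t *\<^sub>R e) \<noteq> 0" if "t \<le> 0" for t
    proof -
      have "w + (- s) *\<^sub>R v + t *\<^sub>R e = - (s *\<^sub>R v - w + (- t) *\<^sub>R e)"
        by simp
      then have "p (w + (- s) *\<^sub>R v + t *\<^sub>R e) = (- 1) ^ d * p (s *\<^sub>R v - w + (- t) *\<^sub>R e)"
        by (simp only: scale_uminus)
      moreover have "p (s *\<^sub>R v - w + (- t) *\<^sub>R e) \<noteq> 0"
      proof (cases "t = 0")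
        case False
        with that have "- t > 0"
          by simp
        with in_cone(2) show ?thesis
          unfolding cone_iff by blast
      qed (use p_pos in simp)
      ultimately show ?thesis
        by simp
    qed
    then have "Z {..<0} (- s) = {}" "z (- s) = 0"
      using neg[of 0] by (auto simp: Z_def z_def)
    ultimately show ?case
      using total[of "- s"] by (auto simp: N_def M_def)
  qed
  then obtain S where S: "\<And>s. s \<ge> S \<Longrightarrow> N s = 0 \<and> N (- s) = d"
    by (auto simp: eventually_at_top_linorder)
  define \<sigma> where "\<sigma> k = Sup {s. k \<le> N s}" for k
  have \<sigma>: "N (\<sigma> k) = k - 1 \<and> p (w + \<sigma> k *\<^sub>R v) = 0" if k: "k \<in> {1..d}" for k
  proof -
    have nonempty: "- S \<in> {s. k \<le> N s}"
      using S[of S] k by simp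
    have bdd: "bdd_above {s. k \<le> N s}"
    proof (rule bdd_aboveI)
      fix s assume "s \<in> {s. k \<le> N s}"
      with S[of s] k show "s \<le> S"
        by (cases "s \<ge> S") auto
    qed
    have "\<forall>\<^sub>F r in nhds (\<sigma> k). N (\<sigma> k) \<le> N r \<and> N r \<le> N (\<sigma> k) + z (\<sigma> k)"
      using semi[OF open_greaterThan, of 0 "\<sigma> k"] semi[OF open_lessThan, of 0 "\<sigma> k"]
      unfolding N_def[symmetric] M_def[symmetric]
    proof eventually_elim
      case (elim r)
      then show ?case
        using total[of r] total[of "\<sigma> k"] by linarith
    qed
    then obtain \<delta> where \<delta>: "\<delta> > 0"
      "\<And>r. dist r (\<sigma> k) < \<delta> \<Longrightarrow> N (\<sigma> k) \<le> N r \<and> N r \<le> N (\<sigma> k) + z (\<sigma> k)"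
      by (auto simp: eventually_nhds_metric)
    have "\<sigma> k + \<delta> / 2 \<notin> {s. k \<le> N s}"
      using cSup_upper[OF _ bdd, of "\<sigma> k + \<delta> / 2"] \<delta>(1) by (auto simp: \<sigma>_def)
    then have "N (\<sigma> k) < k"
      using \<delta>(2)[of "\<sigma> k + \<delta> / 2"] \<delta>(1) by (auto simp: dist_norm)
    moreover obtain r where r: "r \<in> {s. k \<le> N s}" "\<sigma> k - \<delta> / 2 < r"
      using less_cSup_iff[OF _ bdd, of "\<sigma> k - \<delta> / 2"] nonempty \<delta>(1) by (auto simp: \<sigma>_def)
    moreover have "r \<le> \<sigma> k"
      unfolding \<sigma>_def by (rule cSup_upper[OF r(1) bdd])
    ultimately show ?thesis
      using \<delta>(2)[of r] \<delta>(1) by (auto simp: dist_norm z_def split: if_splits)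
  qed
  have "inj_on \<sigma> {1..d}"
  proof (rule inj_onI)
    fix k l assume "k \<in> {1..d}" "l \<in> {1..d}" "\<sigma> k = \<sigma> l"
    then show "k = l"
      using \<sigma>[of k] \<sigma>[of l] by auto
  qed
  then have "card {1..d} \<le> card {s. p (w + s *\<^sub>R v) = 0}"
    using \<sigma> v(2) finite_line_zeros[of v w] by (intro card_inj_on_le) auto
  with card_line_zeros[of v w] v(2) show ?thesis
    by simp
qed

text \<open>
  The eigenvalues are nondecreasing in the directions of the cone.
\<close>

lemma slope_nonneg:
  assumes u: "u \<in> hyp_cone" and w: "p w = 0" "w \<notin> span {e}"
  shows "slope u w \<ge> 0"
proof (rule ccontr)
  assume neg: "\<not> slope u w \<ge> 0"
  define c where "c = - slope u w"
  define v where "v = u + c *\<^sub>R e"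
  have "D e w \<noteq> 0"
    using w by (intro simple_zero')
  then have Dv: "D v w = 0"
    by (simp add: v_def c_def linear_add[OF linear_D] linear_diff[OF linear_D] linear_scale[OF linear_D])
  have v: "v \<in> hyp_cone" "p v > 0"
    using cone_add_e[OF u, of c] neg by (auto simp: v_def c_def)
  show False
  proof (cases "w \<in> span {e, v}")
    case True
    then obtain \<alpha> \<beta> where ab: "w - \<alpha> *\<^sub>R e = \<beta> *\<^sub>R v"
      by (auto simp: span_breakdown_eq span_singleton)
    then have w_eq: "w = \<alpha> *\<^sub>R e + \<beta> *\<^sub>R v"
      by (simp add: algebra_simps)
    \<comment> \<open>Euler's identity at the zero \<open>w\<close>\<close>
    have "D (\<alpha> *\<^sub>R e + \<beta> *\<^sub>R v) w = 0"
      using euler[of w] w(1) by (simp flip: w_eq)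
    then have "\<alpha> = 0"
      using Dv \<open>D e w \<noteq> 0\<close> by (simp add: linear_add[OF linear_D] linear_scale[OF linear_D])
    moreover have "\<beta> \<noteq> 0"
      using w(2) w_eq by (auto simp: span_base span_scale)
    ultimately have "p w \<noteq> 0"
      using v(2) by (simp add: w_eq scale)
    with w show False
      by simp
  next
    case False
    then have "D v (w + 0 *\<^sub>R v) \<noteq> 0"
      using card_zeros_along_cone[OF v] finite_line_zeros[of v w] v(2) w(1)
      by (intro D_at_zero_nonzero[of "{s. p (w + s *\<^sub>R v) = 0}"]) auto
    with Dv show False
      by simp
  qed
qed

section \<open>The boundary of the cone\<close>

lemma cone_nonneg:
  assumes "x \<in> hyp_cone"
  shows "p x \<ge> 0"
proof (rule tendsto_lowerbound)
  have "((\<lambda>t. p (x + t *\<^sub>R e)) \<longlongrightarrow> p (x + 0 *\<^sub>R e)) (at_right 0)"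
    by (intro isCont_tendsto_compose[OF isCont] tendsto_intros)
  then show "((\<lambda>t. p (x + t *\<^sub>R e)) \<longlongrightarrow> p x) (at_right 0)"
    by simp
  show "\<forall>\<^sub>F t in at_right 0. 0 \<le> p (x + t *\<^sub>R e)"
    using eventually_at_right_less[of 0] by eventually_elim (use assms in \<open>auto simp: hyp_cone_def less_imp_le\<close>)
qed simp

text \<open>
  At a simple zero \<open>z\<close> on its boundary, the cone contains initial segments in all directions
  of the open half space \<open>L\<^sub>z > 0\<close>.  Just after leaving \<open>z\<close> in such a direction, \<open>p\<close> is positive,
  and the \<open>d - 1\<close> negative zeros have persisted; a positive zero as the only remaining one
  would make \<open>p\<close> negative.
\<close>

lemma cone_tangent:
  assumes z: "z \<in> hyp_cone" "p z = 0" "card {t. p (z + t *\<^sub>R e) = 0} = d"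
    and u: "slope u z > 0"
  obtains \<epsilon> where "\<epsilon> > 0" "z + \<epsilon> *\<^sub>R u \<in> hyp_cone"
proof -
  have "D e z \<noteq> 0"
    using simple_zero[OF z(3), of 0] z(2) by simp
  moreover have "\<not> D e z < 0"
  proof
    assume "D e z < 0"
    then obtain \<delta> where \<delta>: "\<delta> > 0" "\<And>h. h > 0 \<Longrightarrow> h < \<delta> \<Longrightarrow> p (z + h *\<^sub>R e) < p z"
      using DERIV_neg_dec_right[of "\<lambda>t. p (z + t *\<^sub>R e)" "D e z" 0] has_derivative_line[of z e 0]
      by auto
    have "p (z + (\<delta> / 2) *\<^sub>R e) > 0"
      using z(1) \<delta>(1) by (simp add: hyp_cone_def)
    moreover have "p (z + (\<delta> / 2) *\<^sub>R e) < p z"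
      using \<delta>(1) by (intro \<delta>(2)) auto
    ultimately show False
      using z(2) by simp
  qed
  ultimately have "D u z > 0"
    using u by (auto simp: zero_less_divide_iff)
  then obtain \<delta>1 where \<delta>1: "\<delta>1 > 0" "\<And>h. h > 0 \<Longrightarrow> h < \<delta>1 \<Longrightarrow> p z < p (z + h *\<^sub>R u)"
    using DERIV_pos_inc_right[of "\<lambda>t. p (z + t *\<^sub>R u)" "D u z" 0] has_derivative_line[of z u 0]
    by auto
  have neg_zeros: "card {t\<in>{..<0}. p (z + t *\<^sub>R e) = 0} = d - 1"
  proof -
    have "{t\<in>{..<0}. p (z + t *\<^sub>R e) = 0} = {t. p (z + t *\<^sub>R e) = 0} - {0}"
      using z(1) by (auto simp: cone_iff neq_iff)
    then show ?thesis
      using finite_zeros[of z] z(2,3) by (simp add: card_Diff_singleton)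
  qed
  have "((\<lambda>\<epsilon>. z + \<epsilon> *\<^sub>R u) \<longlongrightarrow> z + 0 *\<^sub>R u) (at_right 0)"
    by (intro tendsto_intros)
  then have lim: "filterlim (\<lambda>\<epsilon>. z + \<epsilon> *\<^sub>R u) (nhds z) (at_right 0)"
    by simp
  have "\<forall>\<^sub>F \<epsilon> in at_right 0. d - 1 \<le> card {t\<in>{..<0}. p (z + \<epsilon> *\<^sub>R u + t *\<^sub>R e) = 0}"
    using eventually_compose_filterlim[OF card_zeros_lower_semicontinuous[OF z(3) open_lessThan[of 0]] lim]
    by (simp only: neg_zeros)
  moreover have "\<forall>\<^sub>F \<epsilon> in at_right 0. \<epsilon> < \<delta>1"
    using \<delta>1(1) by (rule eventually_at_right_real[of 0 \<delta>1, THEN eventually_mono]) auto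
  ultimately have "\<forall>\<^sub>F \<epsilon> in at_right 0. \<epsilon> > 0 \<and> z + \<epsilon> *\<^sub>R u \<in> hyp_cone"
    using eventually_at_right_less[of 0]
  proof eventually_elim
    case (elim \<epsilon>)
    define y where "y = z + \<epsilon> *\<^sub>R u"
    define T where "T = {t\<in>{..<0}. p (y + t *\<^sub>R e) = 0}"
    have "p y > 0"
      using \<delta>1(2)[of \<epsilon>] elim z(2) by (simp add: y_def)
    have "finite T"
      unfolding T_def by (rule finite_subset[OF _ finite_zeros[of y]]) auto
    have "p (y + t *\<^sub>R e) \<noteq> 0" if "t > 0" for t
    proof
      assume zero: "p (y + t *\<^sub>R e) = 0"
      have "t \<notin> T"
        using that by (simp add: T_def)
      have "insert t T \<subseteq> {t. p (y + t *\<^sub>R e) = 0}"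
        using zero by (auto simp: T_def)
      from order_trans[OF card_mono[OF finite_zeros this] card_line_zeros[OF pos_nonzero]]
      have "card (insert t T) \<le> d" .
      moreover have "card (insert t T) = Suc (card T)"
        using \<open>finite T\<close> \<open>t \<notin> T\<close> by simp
      ultimately have "card (insert t T) = d"
        using elim(1) by (simp add: T_def y_def)
      then have "line_poly y e = Polynomial.smult (p e) (root_poly (insert t T))"
        using \<open>finite T\<close> zero by (intro line_poly_eq_root_poly) (auto simp: T_def)
      \<comment> \<open>the sign of \<open>p y\<close> is read off from the complete factorisation\<close>
      from arg_cong[OF this, of "\<lambda>P. poly P 0"]
      have "p y = p e * (- t * (\<Prod>a\<in>T. - a))"
        using \<open>finite T\<close> \<open>t \<notin> T\<close> by (simp add: poly_line_poly poly_root_poly)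
      moreover have "(\<Prod>a\<in>T. - a) > 0"
        by (intro prod_pos) (auto simp: T_def)
      ultimately have "p y < 0"
        using that pos by (simp add: mult_pos_neg)
      with \<open>p y > 0\<close> show False
        by simp
    qed
    then show ?case
      using elim by (simp add: cone_iff y_def)
  qed
  from eventually_happens'[OF trivial_limit_at_right_real this]
  obtain \<epsilon> where "\<epsilon> > 0 \<and> z + \<epsilon> *\<^sub>R u \<in> hyp_cone" ..
  with that show ?thesis
    by blast
qed

lemma zero_on_axis: "d \<ge> 1 \<Longrightarrow> p (c *\<^sub>R e + t *\<^sub>R e) = 0 \<longleftrightarrow> t = - c"
  using pos_nonzero by (auto simp: scale simp flip: scaleR_left_distrib)

lemma axis_in_cone_imp_nonneg:
  assumes "c *\<^sub>R e \<in> hyp_cone" "d \<ge> 1"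
  shows "c \<ge> 0"
proof (rule ccontr)
  assume "\<not> c \<ge> 0"
  then have "- c > 0"
    by simp
  with assms(1) have "p (c *\<^sub>R e + (- c) *\<^sub>R e) \<noteq> 0"
    unfolding cone_iff by blast
  with zero_on_axis[OF assms(2), of c "- c"] show False
    by simp
qed

text \<open>
  A point outside the cone has a positive zero.  Off the axis this zero persists; at \<open>x = ce\<close>
  with \<open>c < 0\<close> it need not be simple, but the points \<open>-y\<close> with \<open>y\<close> near \<open>x\<close> are then interior to
  the cone, and no point \<open>y\<close> of the cone has \<open>-y\<close> interior.
\<close>

lemma closed_cone: "closed hyp_cone"
proof -
  have *: "\<forall>\<^sub>F y in nhds x. y \<in> - hyp_cone" if x: "x \<in> - hyp_cone" for x
  proof -
    obtain t where t: "t > 0" "p (x + t *\<^sub>R e) = 0"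
      using x by (auto simp: cone_iff)
    then have d: "d \<ge> 1"
      using zero_imp_degree_pos by blast
    show ?thesis
    proof (cases "x \<in> span {e}")
      case False
      have "card {t\<in>{0<..}. p (x + t *\<^sub>R e) = 0} > 0"
        using t finite_subset[OF _ finite_zeros[of x], of "{t\<in>{0<..}. p (x + t *\<^sub>R e) = 0}"]
        by (auto simp: card_gt_0_iff)
      moreover have "\<forall>\<^sub>F y in nhds x. card {t\<in>{0<..}. p (x + t *\<^sub>R e) = 0} \<le>
          card {t\<in>{0<..}. p (y + t *\<^sub>R e) = 0}"
        using strict[OF False] by (intro card_zeros_lower_semicontinuous) auto
      ultimately have "\<forall>\<^sub>F y in nhds x. card {t\<in>{0<..}. p (y + t *\<^sub>R e) = 0} > 0"
        by (auto elim: eventually_mono)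
      then show ?thesis
        by eventually_elim (auto simp: card_gt_0_iff cone_iff)
    next
      case True
      then obtain c where c: "x = c *\<^sub>R e"
        by (auto simp: span_singleton)
      with t d have "c < 0"
        by (simp add: zero_on_axis)
      have "- x \<in> hyp_cone" "p (- x) > 0"
        using e_in_cone[of "- c"] scale[of "- c" e] \<open>c < 0\<close> pos by (auto simp: c)
      moreover have "filterlim uminus (nhds (- x)) (nhds x)"
        by (intro tendsto_minus filterlim_ident)
      ultimately have "\<forall>\<^sub>F y in nhds x. - y \<in> hyp_cone \<and> p (- y) > 0"
        using eventually_compose_filterlim[OF eventually_in_cone] by blast
      then show ?thesis
      proof eventually_elim
        case (elim y)
        show ?case
        proof
          assume "y \<in> hyp_cone"
          have no_zero: "p (y + s *\<^sub>R e) \<noteq> 0" for s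
          proof (cases "s > 0")
            case True
            with \<open>y \<in> hyp_cone\<close> show ?thesis
              by (simp add: cone_iff)
          next
            case False
            have "p (- y + (- s) *\<^sub>R e) \<noteq> 0"
            proof (cases "s = 0")
              case False
              with \<open>\<not> s > 0\<close> have "- s > 0" by simp
              with elim show ?thesis
                unfolding cone_iff by blast
            qed (use elim in simp)
            moreover have "y + s *\<^sub>R e = - (- y + (- s) *\<^sub>R e)"
              by simp
            ultimately show ?thesis
              by (metis mult_eq_0_iff power_not_zero scale_uminus zero_neq_neg_one)
          qed
          then have "y \<in> span {e}"
            using strict[of y] d by fastforce
          then show False
            using no_zero d zero_on_axis by (auto simp: span_singleton)
        qed
      qed
    qed
  qed
  have "open (- hyp_cone)"
  proof (rule Topological_Spaces.openI)
    fix x assume "x \<in> - hyp_cone"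
    from *[OF this] obtain S where "open S" "x \<in> S" "\<forall>y\<in>S. y \<in> - hyp_cone"
      unfolding eventually_nhds by blast
    then show "\<exists>T. open T \<and> x \<in> T \<and> T \<subseteq> - hyp_cone"
      by blast
  qed
  then show ?thesis
    by (simp add: open_closed)
qed

section \<open>Residues and the trace\<close>

text \<open>
  The partial fraction decomposition of \<open>D\<^sub>u p\<^sub>x / p\<^sub>x\<close>, multiplied by \<open>p\<^sub>x\<close>: the residue at a zero
  \<open>a\<close> is the slope at \<open>x + ae\<close>.
\<close>

lemma D_line_partial_fractions:
  assumes "card {t. p (x + t *\<^sub>R e) = 0} = d" "d \<ge> 1"
  defines "R \<equiv> {t. p (x + t *\<^sub>R e) = 0}"
  shows "poly_of_fun (\<lambda>t. D u (x + t *\<^sub>R e)) = (\<Sum>a\<in>R. Polynomial.smult (slope u (x + a *\<^sub>R e))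
    (Polynomial.smult (p e) (root_poly (R - {a}))))" (is "?Q = _")
proof -
  have fin: "finite R" and card: "card R = d"
    using finite_zeros assms(1) by (auto simp: R_def)
  have "degree ?Q < card R"
    using degree_D_line[OF assms(2), of u x e] assms(2) card by linarith
  from eq_lagrange_poly[OF fin this]
  have "?Q = (\<Sum>a\<in>R. Polynomial.smult (D u (x + a *\<^sub>R e) / poly (root_poly (R - {a})) a)
      (root_poly (R - {a})))"
    by (simp add: lagrange_poly_def poly_D_line)
  also have "\<dots> = (\<Sum>a\<in>R. Polynomial.smult (slope u (x + a *\<^sub>R e))
      (Polynomial.smult (p e) (root_poly (R - {a}))))"
  proof (rule sum.cong)
    fix a assume "a \<in> R"
    then have "D e (x + a *\<^sub>R e) = p e * poly (root_poly (R - {a})) a"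
      by (intro D_at_zero fin card) (auto simp: R_def)
    then show "Polynomial.smult (D u (x + a *\<^sub>R e) / poly (root_poly (R - {a})) a)
        (root_poly (R - {a})) = Polynomial.smult (slope u (x + a *\<^sub>R e))
      (Polynomial.smult (p e) (root_poly (R - {a})))"
      using pos by simp
  qed simp
  finally show ?thesis .
qed

text \<open>
  Comparison of the coefficients of \<open>t\<^sup>d\<^sup>-\<^sup>1\<close> in the partial fraction decomposition.
\<close>

lemma trace_eq_sum_slopes:
  assumes "card {t. p (x + t *\<^sub>R e) = 0} = d" "d \<ge> 1"
  shows "hyp_trace u = (\<Sum>a | p (x + a *\<^sub>R e) = 0. slope u (x + a *\<^sub>R e))"
proof -
  define R where "R = {t. p (x + t *\<^sub>R e) = 0}"
  have "coeff (root_poly (R - {a})) (d - 1) = 1" if "a \<in> R" for a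
    using coeff_root_poly_card[of "R - {a}"] that assms finite_zeros[of x]
    by (simp add: R_def card_Diff_singleton)
  then have "D u e = (\<Sum>a\<in>R. slope u (x + a *\<^sub>R e) * p e)"
    using coeff_D_line[OF assms(2), of u x e] D_line_partial_fractions[OF assms, of u]
    by (simp add: Polynomial.coeff_sum R_def)
  also have "\<dots> = (\<Sum>a\<in>R. slope u (x + a *\<^sub>R e)) * p e"
    by (simp only: sum_distrib_right)
  finally show ?thesis
    using pos by (simp add: R_def)
qed

lemma slope_self:
  assumes "D e (u + a *\<^sub>R e) \<noteq> 0" "p (u + a *\<^sub>R e) = 0"
  shows "slope u (u + a *\<^sub>R e) = - a"
proof -
  have "D u (u + a *\<^sub>R e) + a * D e (u + a *\<^sub>R e) = 0"
    using euler[of "u + a *\<^sub>R e"] assms(2)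
    by (simp add: linear_add[OF linear_D] linear_scale[OF linear_D])
  with assms(1) show ?thesis
    by (simp add: field_simps)
qed

lemma trace_eq_sum_zeros:
  assumes "card {t. p (u + t *\<^sub>R e) = 0} = d" "d \<ge> 1"
  shows "hyp_trace u = (\<Sum>a | p (u + a *\<^sub>R e) = 0. - a)"
  unfolding trace_eq_sum_slopes[OF assms, of u]
  using simple_zero[OF assms(1)] by (intro sum.cong refl slope_self) auto

lemma trace_on_axis: "hyp_trace (c *\<^sub>R e) = c * real d"
  using euler[of e] pos by (simp add: linear_scale[OF linear_D])

lemma trace_nonneg:
  assumes "u \<in> hyp_cone" "d \<ge> 1"
  shows "hyp_trace u \<ge> 0"
proof (cases "u \<in> span {e}")
  case True
  then obtain c where c: "u = c *\<^sub>R e"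
    by (auto simp: span_singleton)
  have "c \<ge> 0"
    using assms axis_in_cone_imp_nonneg[of c] by (simp add: c)
  then show ?thesis
    unfolding c trace_on_axis by simp
next
  case False
  show ?thesis
    unfolding trace_eq_sum_zeros[OF strict[OF False] assms(2)]
    using assms(1) by (intro sum_nonneg) (auto simp: cone_iff not_less[symmetric])
qed

lemma trace_pos:
  assumes "u \<in> hyp_cone" "u \<noteq> 0" "d \<ge> 2"
  shows "hyp_trace u > 0"
proof (cases "u \<in> span {e}")
  case True
  then obtain c where c: "u = c *\<^sub>R e"
    by (auto simp: span_singleton)
  have "c \<ge> 0"
    using assms axis_in_cone_imp_nonneg[of c] by (simp add: c)
  with assms(2) have "c > 0"
    by (cases "c = 0") (auto simp: c)
  then show ?thesis
    using assms(3) unfolding c trace_on_axis by simp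
next
  case False
  define R where "R = {t. p (u + t *\<^sub>R e) = 0}"
  have R: "card R = d" "finite R"
    using strict[OF False] finite_zeros by (auto simp: R_def)
  have "\<not> R \<subseteq> {0}"
    using card_mono[of "{0 :: real}" R] R assms(3) by auto
  then obtain b where b: "b \<in> R" "b \<noteq> 0"
    by auto
  have nonpos: "a \<le> 0" if "a \<in> R" for a
    using that assms(1) by (auto simp: R_def cone_iff not_less[symmetric])
  have "(\<Sum>a\<in>R. - a) > 0"
    using nonpos b R(2) by (intro sum_pos2[of R b]) (auto simp: less_le)
  then show ?thesis
    using trace_eq_sum_zeros[OF strict[OF False]] assms(3) by (simp add: R_def)
qed

end

section \<open>The Hermite matrix\<close>

text \<open>
  If the Hankel entries are the moments of the signed measure with mass \<open>w a\<close> at each \<open>a \<in> R\<close>, the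
  quadratic form integrates the square of the polynomial with coefficients \<open>y\<close>.
\<close>

lemma hermite_map_eq_sum:
  fixes y :: "real vec"
  assumes h: "\<And>k. hermite_coeff p e x u (k + 1) = (\<Sum>a\<in>R. w a * a ^ k)"
    and y: "y \<in> carrier_vec d"
  shows "hermite_map d p e x y u = (\<Sum>a\<in>R. w a * (\<Sum>i<d. y $ i * a ^ i)\<^sup>2)"
proof -
  have "hermite_map d p e x y u =
      (\<Sum>i<d. y $ i * (\<Sum>j<d. hermite_coeff p e x u (i + j + 1) * y $ j))"
    using y by (simp add: hermite_map_def hermite_matrix_def scalar_prod_def lessThan_atLeast0)
  also have "\<dots> = (\<Sum>i<d. \<Sum>j<d. \<Sum>a\<in>R. w a * (y $ i * a ^ i) * (y $ j * a ^ j))"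
    unfolding h by (simp add: sum_distrib_left sum_distrib_right power_add mult_ac)
  also have "\<dots> = (\<Sum>a\<in>R. \<Sum>i<d. \<Sum>j<d. w a * (y $ i * a ^ i) * (y $ j * a ^ j))"
    by (simp only: sum.swap[of _ "{..<d}" R])
  also have "\<dots> = (\<Sum>a\<in>R. w a * (\<Sum>i<d. y $ i * a ^ i)\<^sup>2)"
    unfolding power2_eq_square sum_product by (simp only: sum_distrib_left mult.assoc)
  finally show ?thesis .
qed

lemma hermite_map_degree_0: "y \<in> carrier_vec 0 \<Longrightarrow> hermite_map 0 p e x y = (\<lambda>_. 0)"
  by (simp add: hermite_map_def hermite_matrix_def scalar_prod_def fun_eq_iff)

lemma poly_eq_sum_vec:
  assumes "degree q < d"
  shows "(\<Sum>i<d. vec d (coeff q) $ i * a ^ i) = poly q (a :: real)"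
proof -
  have "poly q a = (\<Sum>i\<le>degree q. coeff q i * a ^ i)"
    by (rule poly_altdef)
  also have "\<dots> = (\<Sum>i<d. coeff q i * a ^ i)"
    using assms by (intro sum.mono_neutral_left) (auto simp: coeff_eq_0)
  finally show ?thesis
    by simp
qed

context strict_form
begin

lemma hermite_map_off_axis:
  fixes y :: "real vec"
  assumes "card {t. p (x + t *\<^sub>R e) = 0} = d" "d \<ge> 1" "y \<in> carrier_vec d"
  shows "hermite_map d p e x y u =
    (\<Sum>a | p (x + a *\<^sub>R e) = 0. slope u (x + a *\<^sub>R e) * (\<Sum>i<d. y $ i * a ^ i)\<^sup>2)"
proof (rule hermite_map_eq_sum[OF _ assms(3)])
  fix k
  define R where "R = {t. p (x + t *\<^sub>R e) = 0}"
  have fin: "finite R" and card: "card R = d"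
    using finite_zeros assms(1) by (auto simp: R_def)
  have "line_poly x e = Polynomial.smult (p e) (root_poly R)"
    using fin card by (intro line_poly_eq_root_poly) (auto simp: R_def)
  then have factor: "line_poly x e = [:- a, 1:] * Polynomial.smult (p e) (root_poly (R - {a}))"
    if "a \<in> R" for a
    using root_poly_remove[OF fin that] by (simp only: mult_smult_right)
  show "hermite_coeff p e x u (k + 1) =
      (\<Sum>a | p (x + a *\<^sub>R e) = 0. slope u (x + a *\<^sub>R e) * a ^ k)"
    using expand_partial_fractions[OF line_poly_nonzero[OF pos_nonzero] factor
        D_line_partial_fractions[OF assms(1,2), of u, folded R_def], of k]
    by (simp add: hermite_coeff_def R_def add.commute)
qed

text \<open>
  For \<open>x = ce\<close> numerator and denominator are multiples of powers of \<open>t + c\<close>, and their quotient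
  \<open>\<eta>(u) / (t + c)\<close> has the single pole \<open>-c\<close>.
\<close>

lemma hermite_map_on_axis:
  fixes y :: "real vec"
  assumes "d \<ge> 1" "y \<in> carrier_vec d"
  shows "hermite_map d p e (c *\<^sub>R e) y u = hyp_trace u * (\<Sum>i<d. y $ i * (- c) ^ i)\<^sup>2"
proof -
  define F where "F = Polynomial.smult (p e) ([:c, 1:] ^ (d - 1))"
  have "line_poly (c *\<^sub>R e) e = [:c, 1:] * F"
  proof (rule poly_eq_on_ray[of 0])
    fix t :: real
    have "poly (line_poly (c *\<^sub>R e) e) t = (c + t) ^ d * p e"
      unfolding poly_line_poly by (simp only: scale flip: scaleR_left_distrib)
    also have "(c + t) ^ d = (c + t) * (c + t) ^ (d - 1)"
      using assms(1) by (cases d) auto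
    finally show "poly (line_poly (c *\<^sub>R e) e) t = poly ([:c, 1:] * F) t"
      by (simp add: F_def poly_power del: mult_pCons_left)
  qed
  moreover have "poly_of_fun (\<lambda>t. D u (c *\<^sub>R e + t *\<^sub>R e)) = Polynomial.smult (hyp_trace u) F"
  proof (rule poly_eq_on_ray[of "- c"])
    fix t :: real assume "t > - c"
    then have "c + t > 0"
      by simp
    moreover have "(c + t) ^ d = (c + t) * (c + t) ^ (d - 1)"
      using assms(1) by (cases d) auto
    ultimately have *: "D u ((c + t) *\<^sub>R e) = (c + t) ^ (d - 1) * D u e"
      using D_scale[of "c + t" u e] by (simp del: power_Suc)
    have "poly (poly_of_fun (\<lambda>t. D u (c *\<^sub>R e + t *\<^sub>R e))) t = (c + t) ^ (d - 1) * D u e"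
      unfolding poly_D_line by (simp only: * flip: scaleR_left_distrib)
    then show "poly (poly_of_fun (\<lambda>t. D u (c *\<^sub>R e + t *\<^sub>R e))) t =
        poly (Polynomial.smult (hyp_trace u) F) t"
      using pos by (simp add: F_def poly_power)
  qed
  ultimately have "hermite_coeff p e (c *\<^sub>R e) u (k + 1) = (\<Sum>a\<in>{- c}. hyp_trace u * a ^ k)" for k
    using expand_partial_fractions[of "line_poly (c *\<^sub>R e) e" "{- c}" "\<lambda>_. F" _ "\<lambda>_. hyp_trace u" k]
      line_poly_nonzero[OF pos_nonzero, of "c *\<^sub>R e"]
    by (simp add: hermite_coeff_def add.commute)
  from hermite_map_eq_sum[OF this assms(2)] show ?thesis
    by simp
qed

lemma hermite_map_in_dual_cone:
  assumes y: "y \<in> carrier_vec d"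
  shows "hermite_map d p e x y \<in> dual_cone hyp_cone"
proof (cases "d = 0")
  case True
  with y have "hermite_map d p e x y = (\<lambda>_. 0)"
    using hermite_map_degree_0 by blast
  then show ?thesis
    by (simp add: dual_cone_def linear_zero)
next
  case False
  then have d: "d \<ge> 1"
    by simp
  have lin: "linear (\<lambda>u. \<Sum>a\<in>R. D u (W a) / v a * k a)" for R W and v k :: "real \<Rightarrow> real"
    by (intro linearI) (simp_all add: linear_add[OF linear_D] linear_scale[OF linear_D]
        sum.distrib add_divide_distrib distrib_right sum_distrib_left mult.assoc)
  show ?thesis
  proof (cases "x \<in> span {e}")
    case True
    then obtain c where c: "x = c *\<^sub>R e"
      by (auto simp: span_singleton)
    define k where "k = (\<Sum>i<d. y $ i * (- c) ^ i)\<^sup>2"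
    have map_eq: "hermite_map d p e x y = (\<lambda>u. hyp_trace u * k)"
      unfolding c k_def by (rule ext) (rule hermite_map_on_axis[OF d y])
    have "linear (\<lambda>u. hyp_trace u * k)"
      using lin[of "\<lambda>_. e" "\<lambda>_. p e" "\<lambda>_. k" "{0}"] by simp
    moreover have "hyp_trace u * k \<ge> 0" if "u \<in> hyp_cone" for u
      using trace_nonneg[OF that d] by (intro mult_nonneg_nonneg) (auto simp: k_def)
    ultimately show ?thesis
      by (simp add: dual_cone_def map_eq)
  next
    case False
    have "hermite_map d p e x y = (\<lambda>u. \<Sum>a | p (x + a *\<^sub>R e) = 0.
        slope u (x + a *\<^sub>R e) * (\<Sum>i<d. y $ i * a ^ i)\<^sup>2)"
      by (rule ext) (rule hermite_map_off_axis[OF strict[OF False] d y])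
    then have "linear (hermite_map d p e x y)"
      by (simp only: lin)
    moreover have "hermite_map d p e x y u \<ge> 0" if "u \<in> hyp_cone" for u
      unfolding hermite_map_off_axis[OF strict[OF False] d y]
    proof (intro sum_nonneg mult_nonneg_nonneg zero_le_power2)
      fix a assume "a \<in> {a. p (x + a *\<^sub>R e) = 0}"
      moreover have "x + a *\<^sub>R e \<notin> span {e}"
        using False span_add_eq2[of "a *\<^sub>R e" "{e}" x] by (simp add: span_base span_scale)
      ultimately show "slope u (x + a *\<^sub>R e) \<ge> 0"
        using that by (intro slope_nonneg) auto
    qed
    ultimately show ?thesis
      by (simp add: dual_cone_def)
  qed
qed

section \<open>Realising functionals of the dual cone\<close>

lemma realize_on_axis:
  assumes "d \<ge> 1" "s \<ge> 0"
  shows "\<exists>x y. y \<in> carrier_vec d \<and> hermite_map d p e x y = (\<lambda>u. s * hyp_trace u)"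
proof (intro exI conjI)
  let ?y = "vec d (coeff [:sqrt s:])"
  show "?y \<in> carrier_vec d"
    by simp
  show "hermite_map d p e (1 *\<^sub>R e) ?y = (\<lambda>u. s * hyp_trace u)"
  proof
    fix u
    have "hermite_map d p e (1 *\<^sub>R e) ?y u = hyp_trace u * (\<Sum>i<d. ?y $ i * (- 1) ^ i)\<^sup>2"
      using assms(1) by (intro hermite_map_on_axis) simp_all
    also have "(\<Sum>i<d. ?y $ i * (- 1) ^ i) = poly [:sqrt s:] (- 1)"
      using assms(1) by (intro poly_eq_sum_vec) simp
    finally show "hermite_map d p e (1 *\<^sub>R e) ?y u = s * hyp_trace u"
      using assms(2) by simp
  qed
qed

lemma realize_weights:
  assumes "card {t. p (x + t *\<^sub>R e) = 0} = d" "d \<ge> 1" "\<And>a. w a \<ge> 0"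
  shows "\<exists>y. y \<in> carrier_vec d \<and>
    hermite_map d p e x y = (\<lambda>u. \<Sum>a | p (x + a *\<^sub>R e) = 0. slope u (x + a *\<^sub>R e) * w a)"
proof (intro exI conjI)
  define R where "R = {t. p (x + t *\<^sub>R e) = 0}"
  have R: "finite R" "card R = d"
    using finite_zeros assms(1) by (auto simp: R_def)
  with assms(2) have "R \<noteq> {}"
    by auto
  define q where "q = lagrange_poly R (\<lambda>a. sqrt (w a))"
  have "degree q < d"
    using degree_lagrange_poly[OF R(1) \<open>R \<noteq> {}\<close>] R(2) by (simp add: q_def)
  let ?y = "vec d (coeff q)"
  show carrier: "?y \<in> carrier_vec d"
    by simp
  show "hermite_map d p e x ?y =
      (\<lambda>u. \<Sum>a | p (x + a *\<^sub>R e) = 0. slope u (x + a *\<^sub>R e) * w a)"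
  proof
    fix u
    have "hermite_map d p e x ?y u =
        (\<Sum>a\<in>R. slope u (x + a *\<^sub>R e) * (\<Sum>i<d. ?y $ i * a ^ i)\<^sup>2)"
      unfolding R_def by (rule hermite_map_off_axis[OF assms(1,2) carrier])
    also have "\<dots> = (\<Sum>a\<in>R. slope u (x + a *\<^sub>R e) * w a)"
    proof (rule sum.cong)
      fix a assume "a \<in> R"
      then have "poly q a = sqrt (w a)"
        unfolding q_def using R(1) by (intro poly_lagrange_poly)
      then show "slope u (x + a *\<^sub>R e) * (\<Sum>i<d. ?y $ i * a ^ i)\<^sup>2 = slope u (x + a *\<^sub>R e) * w a"
        unfolding poly_eq_sum_vec[OF \<open>degree q < d\<close>] using assms(3) by simp
    qed simp
    finally show "hermite_map d p e x ?y u =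
        (\<Sum>a | p (x + a *\<^sub>R e) = 0. slope u (x + a *\<^sub>R e) * w a)"
      by (simp only: R_def)
  qed
qed

text \<open>
  The cone has only one supporting hyperplane at a simple zero \<open>z\<close>: by \<open>cone_tangent\<close> a
  supporting functional is nonnegative on the half space \<open>L\<^sub>z > 0\<close>, hence proportional to \<open>L\<^sub>z\<close>.
\<close>

lemma supporting_functional:
  fixes \<xi> :: "real ^ 'n \<Rightarrow> real"
  assumes \<xi>: "linear \<xi>" "\<And>u. u \<in> hyp_cone \<Longrightarrow> \<xi> u \<ge> 0"
    and z: "z \<in> hyp_cone" "p z = 0" "card {t. p (z + t *\<^sub>R e) = 0} = d" "\<xi> z = 0"
  shows "\<xi> u = \<xi> e * slope u z"
proof -
  have De: "D e z \<noteq> 0"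
    using simple_zero[OF z(3), of 0] z(2) by simp
  have pos_imp: "\<xi> u \<ge> 0" if u: "slope u z > 0" for u
  proof -
    obtain \<epsilon> where \<epsilon>: "\<epsilon> > 0" "z + \<epsilon> *\<^sub>R u \<in> hyp_cone"
      using cone_tangent[OF z(1-3) u] by blast
    from \<xi>(2)[OF \<epsilon>(2)] \<epsilon>(1) z(4) show ?thesis
      by (simp add: linear_add[OF \<xi>(1)] linear_scale[OF \<xi>(1)] real_scaleR_def zero_le_mult_iff)
  qed
  \<comment> \<open>the kernel of \<open>L\<^sub>z\<close> is approached from the open half space by adding multiples of \<open>e\<close>\<close>
  have ker: "\<xi> v \<ge> 0" if "D v z = 0" for v
  proof (rule field_le_epsilon)
    fix \<epsilon> :: real assume "\<epsilon> > 0"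
    define \<delta> where "\<delta> = \<epsilon> / (\<bar>\<xi> e\<bar> + 1)"
    have \<delta>: "\<delta> > 0" "\<delta> * \<bar>\<xi> e\<bar> \<le> \<epsilon>"
      using \<open>\<epsilon> > 0\<close> by (auto simp: \<delta>_def field_simps)
    have "slope (v + \<delta> *\<^sub>R e) z > 0"
      using De \<delta>(1) that by (simp add: linear_add[OF linear_D] linear_scale[OF linear_D])
    from pos_imp[OF this] have "0 \<le> \<xi> v + \<delta> * \<xi> e"
      by (simp add: linear_add[OF \<xi>(1)] linear_scale[OF \<xi>(1)])
    also have "\<delta> * \<xi> e \<le> \<delta> * \<bar>\<xi> e\<bar>"
      using \<delta>(1) by (intro mult_left_mono) auto
    finally show "0 \<le> \<xi> v + \<epsilon>"
      using \<delta>(2) by linarith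
  qed
  define v where "v = u - slope u z *\<^sub>R e"
  have "D v z = 0"
    using De by (simp add: v_def linear_diff[OF linear_D] linear_scale[OF linear_D])
  then have "\<xi> v \<ge> 0" "\<xi> (- v) \<ge> 0"
    using ker[of v] ker[of "- v"] by (auto simp: linear_neg[OF linear_D])
  then have "\<xi> v = 0"
    by (simp add: linear_neg[OF \<xi>(1)])
  then show ?thesis
    by (simp add: v_def linear_diff[OF \<xi>(1)] linear_scale[OF \<xi>(1)] mult.commute)
qed

lemma realize_boundary:
  fixes \<xi> :: "real ^ 'n \<Rightarrow> real"
  assumes \<xi>: "linear \<xi>" "\<And>u. u \<in> hyp_cone \<Longrightarrow> \<xi> u \<ge> 0"
    and z: "z \<in> hyp_cone" "p z = 0" "card {t. p (z + t *\<^sub>R e) = 0} = d" "\<xi> z = 0"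
    and s: "s \<ge> 0"
  shows "\<exists>x y. y \<in> carrier_vec d \<and> hermite_map d p e x y = (\<lambda>u. s * hyp_trace u + \<xi> u)"
proof -
  have d: "d \<ge> 1"
    using z(2) by (rule zero_imp_degree_pos)
  \<comment> \<open>\<open>z\<close> itself is the zero \<open>a = 0\<close> of its line, and the slopes at all zeros add up to the trace\<close>
  define w where "w a = s + (if a = 0 then \<xi> e else 0)" for a :: real
  have "\<xi> e \<ge> 0"
    using \<xi>(2) e_in_cone[of 1] by simp
  then have "w a \<ge> 0" for a
    using s by (simp add: w_def)
  then obtain y where y: "y \<in> carrier_vec d" "hermite_map d p e z y =
      (\<lambda>u. \<Sum>a | p (z + a *\<^sub>R e) = 0. slope u (z + a *\<^sub>R e) * w a)"
    using realize_weights[OF z(3) d] by blast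
  have "(\<Sum>a | p (z + a *\<^sub>R e) = 0. slope u (z + a *\<^sub>R e) * w a) = s * hyp_trace u + \<xi> u" for u
  proof -
    have "(\<Sum>a | p (z + a *\<^sub>R e) = 0. slope u (z + a *\<^sub>R e) * w a) =
        (\<Sum>a | p (z + a *\<^sub>R e) = 0. slope u (z + a *\<^sub>R e)) * s +
        (\<Sum>a | p (z + a *\<^sub>R e) = 0. if a = 0 then slope u z * \<xi> e else 0)"
      unfolding sum_distrib_right sum.distrib[symmetric]
      by (rule sum.cong) (auto simp: w_def distrib_left)
    also have "(\<Sum>a | p (z + a *\<^sub>R e) = 0. slope u (z + a *\<^sub>R e)) = hyp_trace u"
      by (rule trace_eq_sum_slopes[OF z(3) d, symmetric])
    also have "(\<Sum>a | p (z + a *\<^sub>R e) = 0. if a = 0 then slope u z * \<xi> e else 0) = slope u z * \<xi> e"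
      using finite_zeros[of z] z(2) by (simp add: sum.delta)
    also have "\<dots> = \<xi> u"
      using supporting_functional[OF \<xi> z, of u] by (simp add: mult.commute)
    finally show ?thesis
      by (simp add: mult.commute)
  qed
  with y show ?thesis
    by (intro exI[of _ z] exI[of _ y]) simp
qed

text \<open>
  The quotient of \<open>\<xi>\<close> by the trace attains a minimum \<open>s\<close> on the cone without the origin, since
  the unit vectors in the cone form a compact set.  The assumption \<open>d \<ge> 2\<close> makes the trace
  positive there; for \<open>d = 1\<close> the cone is a half space, on whose boundary the trace vanishes.
\<close>

lemma minimal_trace_ratio:
  fixes \<xi> :: "real ^ 'n \<Rightarrow> real"
  assumes \<xi>: "linear \<xi>" "\<And>u. u \<in> hyp_cone \<Longrightarrow> \<xi> u \<ge> 0" and d: "d \<ge> 2"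
  obtains s z where "s \<ge> 0" "z \<in> hyp_cone" "z \<noteq> 0" "\<xi> z = s * hyp_trace z"
    "\<And>u. u \<in> hyp_cone \<Longrightarrow> s * hyp_trace u \<le> \<xi> u"
proof -
  define K where "K = hyp_cone \<inter> sphere 0 1"
  have K: "u \<in> hyp_cone" "u \<noteq> 0" if "u \<in> K" for u
    using that by (auto simp: K_def)
  have normalize: "u \<in> hyp_cone \<Longrightarrow> u \<noteq> 0 \<Longrightarrow> (1 / norm u) *\<^sub>R u \<in> K" for u
    unfolding K_def by (auto intro!: cone_scale)
  have "p 0 = 0"
    using scale[of 0 e] d by (simp add: zero_power)
  then have "e \<noteq> 0"
    using pos by auto
  then have "K \<noteq> {}"
    using normalize[of e] e_in_cone[of 1] by auto
  have "compact K"
    unfolding K_def using closed_cone by (rule closed_Int_compact) simp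
  have "continuous_on K (\<lambda>u. \<xi> u / hyp_trace u)"
    using trace_pos[OF K] d pos
    by (intro continuous_intros linear_continuous_on)
      (auto simp: less_le \<xi>(1) linear_D simp flip: linear_conv_bounded_linear)
  from continuous_attains_inf[OF \<open>compact K\<close> \<open>K \<noteq> {}\<close> this]
  obtain z where z: "z \<in> K" "\<And>u. u \<in> K \<Longrightarrow> \<xi> z / hyp_trace z \<le> \<xi> u / hyp_trace u"
    by blast
  define s where "s = \<xi> z / hyp_trace z"
  have "s \<ge> 0"
    unfolding s_def using \<xi>(2) K[OF z(1)] trace_pos[of z] d by (intro divide_nonneg_pos) auto
  moreover have "\<xi> z = s * hyp_trace z"
    unfolding s_def using trace_pos[OF K[OF z(1)] d] by (simp add: less_le)
  moreover have "s * hyp_trace u \<le> \<xi> u" if u: "u \<in> hyp_cone" for u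
  proof (cases "u = 0")
    case True
    then show ?thesis
      by (simp add: linear_0[OF linear_D] linear_0[OF \<xi>(1)])
  next
    case False
    have "s \<le> \<xi> ((1 / norm u) *\<^sub>R u) / hyp_trace ((1 / norm u) *\<^sub>R u)"
      unfolding s_def by (rule z(2)[OF normalize[OF u False]])
    also have "\<dots> = \<xi> u / hyp_trace u"
      using False by (simp add: linear_scale[OF linear_D] linear_scale[OF \<xi>(1)])
    finally show ?thesis
      using trace_pos[OF u False d] by (simp only: pos_le_divide_eq)
  qed
  ultimately show ?thesis
    using that K[OF z(1)] by blast
qed

lemma functional_zero_of_interior_zero:
  fixes \<xi> :: "real ^ 'n \<Rightarrow> real"
  assumes \<xi>: "linear \<xi>" "\<And>u. u \<in> hyp_cone \<Longrightarrow> \<xi> u \<ge> 0"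
    and z: "z \<in> hyp_cone" "p z > 0" "\<xi> z = 0"
  shows "\<xi> u = 0"
proof -
  have nonneg: "\<xi> u \<ge> 0" for u
  proof -
    have "((\<lambda>\<epsilon>. z + \<epsilon> *\<^sub>R u) \<longlongrightarrow> z + 0 *\<^sub>R u) (at_right 0)"
      by (intro tendsto_intros)
    then have "filterlim (\<lambda>\<epsilon>. z + \<epsilon> *\<^sub>R u) (nhds z) (at_right 0)"
      by simp
    from eventually_compose_filterlim[OF eventually_in_cone[OF z(1,2)] this]
    have "\<forall>\<^sub>F \<epsilon> in at_right 0. z + \<epsilon> *\<^sub>R u \<in> hyp_cone \<and> \<epsilon> > 0"
      using eventually_at_right_less[of 0] by eventually_elim simp
    from eventually_happens'[OF trivial_limit_at_right_real this]
    obtain \<epsilon> where \<epsilon>: "z + \<epsilon> *\<^sub>R u \<in> hyp_cone \<and> \<epsilon> > 0" ..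
    then have "\<xi> (z + \<epsilon> *\<^sub>R u) \<ge> 0"
      by (intro \<xi>(2)) simp
    with \<epsilon> z(3) show ?thesis
      by (simp add: linear_add[OF \<xi>(1)] linear_scale[OF \<xi>(1)] real_scaleR_def zero_le_mult_iff)
  qed
  from nonneg[of u] nonneg[of "- u"] show ?thesis
    by (simp add: linear_neg[OF \<xi>(1)])
qed

lemma realize_dual_cone:
  assumes "\<xi> \<in> dual_cone hyp_cone"
  shows "\<exists>x y. y \<in> carrier_vec d \<and> hermite_map d p e x y = \<xi>"
proof -
  have \<xi>: "linear \<xi>" "\<And>u. u \<in> hyp_cone \<Longrightarrow> \<xi> u \<ge> 0"
    using assms by (auto simp: dual_cone_def)
  consider "d = 0" | "d = 1" | "d \<ge> 2"
    by linarith
  then show ?thesis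
  proof cases
    case 1
    \<comment> \<open>\<open>p\<close> is constant, the cone is the whole space, and its dual is \<open>0\<close>\<close>
    have const: "p x = p e" for x
      using scale[of 0 x] scale[of 0 e] 1 by simp
    have p_pos: "p x > 0" for x
      using const[of x] pos by simp
    have "0 \<in> hyp_cone"
      unfolding hyp_cone_def using p_pos by blast
    then have "\<xi> u = 0" for u
      using functional_zero_of_interior_zero[OF \<xi> _ p_pos linear_0[OF \<xi>(1)]] by blast
    then have "hermite_map d p e e (vec 0 (\<lambda>_. 0)) = \<xi>"
      using 1 hermite_map_degree_0[of "vec 0 (\<lambda>_. 0)"] by (simp add: fun_eq_iff)
    then show ?thesis
      using 1 by (intro exI[of _ e] exI[of _ "vec 0 (\<lambda>_. 0)"]) simp
  next
    case 2
    \<comment> \<open>the cone is a half space, and \<open>0\<close> is a simple zero on its boundary\<close>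
    have zero: "p (0 + t *\<^sub>R e) = 0 \<longleftrightarrow> t = 0" for t
      using 2 pos by (simp add: scale)
    have "\<exists>x y. y \<in> carrier_vec d \<and> hermite_map d p e x y = (\<lambda>u. 0 * hyp_trace u + \<xi> u)"
    proof (rule realize_boundary[OF \<xi>])
      show "0 \<in> hyp_cone" "p 0 = 0"
        using zero zero[of 0] by (auto simp: cone_iff)
      show "card {t. p (0 + t *\<^sub>R e) = 0} = d"
        unfolding zero using 2 by simp
    qed (simp_all add: linear_0[OF \<xi>(1)])
    then show ?thesis
      by simp
  next
    case 3
    obtain s z where s: "s \<ge> 0" and z: "z \<in> hyp_cone" "z \<noteq> 0" "\<xi> z = s * hyp_trace z"
      and le: "\<And>u. u \<in> hyp_cone \<Longrightarrow> s * hyp_trace u \<le> \<xi> u"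
      using minimal_trace_ratio[OF \<xi> 3] by blast
    define \<eta> where "\<eta> u = \<xi> u - s * hyp_trace u" for u
    have \<eta>: "linear \<eta>" "\<And>u. u \<in> hyp_cone \<Longrightarrow> \<eta> u \<ge> 0" "\<eta> z = 0"
      using le z(3) pos unfolding \<eta>_def
      by (auto intro!: linearI simp: linear_add[OF linear_D] linear_scale[OF linear_D]
          linear_add[OF \<xi>(1)] linear_scale[OF \<xi>(1)] field_simps)
    have \<xi>_eq: "\<xi> = (\<lambda>u. s * hyp_trace u + \<eta> u)"
      by (simp add: \<eta>_def)
    show ?thesis
    proof (cases "p z = 0")
      case True
      have "z \<notin> span {e}"
      proof
        assume "z \<in> span {e}"
        then obtain c where "z = c *\<^sub>R e"
          by (auto simp: span_singleton)
        with True z(2) pos show False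
          by (simp add: scale)
      qed
      then show ?thesis
        unfolding \<xi>_eq using True s z(1) \<eta> by (intro realize_boundary strict) auto
    next
      case False
      then have "p z > 0"
        using cone_nonneg[OF z(1)] by simp
      then have "\<xi> = (\<lambda>u. s * hyp_trace u)"
        using functional_zero_of_interior_zero[OF \<eta>(1,2) z(1) _ \<eta>(3)] by (subst \<xi>_eq) simp
      then show ?thesis
        using realize_on_axis[of s] s 3 by simp
    qed
  qed
qed

end

section \<open>Strictly hyperbolic forms\<close>

lemma strict_form_of_hyperbolic:
  assumes "p \<in> hyperbolic_forms d e" "strictly_hyperbolic d p e"
  shows "strict_form p d e"
proof -
  interpret form p d
    using assms(1) by (simp add: form_def hyperbolic_forms_def)
  have pos: "p e > 0"
    using assms(1) by (simp add: hyperbolic_forms_def)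
  show ?thesis
  proof
    fix x assume x: "x \<notin> span {e}"
    have "hyperbolic_eigenvalues p e (- x) = proots (line_poly x e)"
      by (simp add: hyperbolic_eigenvalues_def add.commute)
    then have "set_mset (hyperbolic_eigenvalues p e (- x)) = {t. p (x + t *\<^sub>R e) = 0}"
      using line_poly_nonzero[of e x] pos by (simp add: poly_line_poly)
    moreover have "\<nexists>c. - x = c *\<^sub>R e"
      using x by (metis minus_minus rangeI scaleR_minus_left span_singleton)
    ultimately show "card {t. p (x + t *\<^sub>R e) = 0} = d"
      using assms(2) by (auto simp: strictly_hyperbolic_def)
  qed (rule pos)
qed

lemma (in strict_form) hyperbolicity_cone_eq: "hyperbolicity_cone p e = hyp_cone"
proof -
  have "set_mset (hyperbolic_eigenvalues p e x) = {t. p (t *\<^sub>R e - x) = 0}" for x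
    using line_poly_nonzero[OF pos_nonzero, of "- x"] poly_line_poly[of "- x" e]
    by (simp add: hyperbolic_eigenvalues_def)
  moreover have "p (t *\<^sub>R e - x) = 0 \<longleftrightarrow> p (x + (- t) *\<^sub>R e) = 0" for t x
    using scale_uminus[of "x + (- t) *\<^sub>R e"] by simp
  ultimately have *: "x \<in> hyperbolicity_cone p e \<longleftrightarrow> (\<forall>t. p (x + (- t) *\<^sub>R e) = 0 \<longrightarrow> t \<ge> 0)" for x
    by (simp add: hyperbolicity_cone_def)
  have "x \<in> hyperbolicity_cone p e \<longleftrightarrow> x \<in> hyp_cone" for x
    unfolding * cone_iff by (metis minus_minus neg_less_0_iff_less not_less)
  then show ?thesis
    by blast
qed

theorem proposition7p5:
  fixes p :: "real ^ 'n \<Rightarrow> real" and e :: "real ^ 'n" and d :: nat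
  assumes "p \<in> hyperbolic_forms d e"
    and "strictly_hyperbolic d p e"
  shows "{hermite_map d p e x y | x y. y \<in> carrier_vec d} = dual_cone (hyperbolicity_cone p e)"
proof -
  interpret strict_form p d e
    using assms by (rule strict_form_of_hyperbolic)
  show ?thesis
    unfolding hyperbolicity_cone_eq using hermite_map_in_dual_cone realize_dual_cone by blast
qed

end
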